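(* Let $\xi\sim\nu$ be a random vector and let $f(\cdot;\xi):\mathbb{R}^d\to\mathbb{R}$ satisfy $\sup_\xi\|f(\cdot;\xi)\|_{C^2}<\infty$. For $\eta>0$ define $S$ on $L^\infty(\mathbb{R}^d)$ by $Su(x)=\mathbb{E}\big(u(x-\eta\nabla f(x;\xi))\big)$. If $\eta$ is sufficiently small, then there exists $S^*:L^1(\mathbb{R}^d)\to L^1(\mathbb{R}^d)$ such that $S$ is the dual of $S^*$, and $S^*$ is given by $$S^*\rho=\mathbb{E}\left(\frac{\rho}{|\det(I-\eta\nabla^2 f(\cdot;\xi))|}\circ h(\cdot;\xi)\right),$$ where $h(\cdot;\xi)$ is the inverse mapping of $x\mapsto x-\eta\nabla f(x;\xi)$ and $\circ$ denotes composition of functions. Further, $S^*$ satisfies: (i) $\int_{\mathbb{R}^d}S^*\rho\,dx=\int_{\mathbb{R}^d}\rho\,dx$ for $\rho\in L^1(\mathbb{R}^d)$. (ii) If $\rho\in L^1(\mathbb{R}^d)$ is nonnegative, then $S^*\rho\ge 0$ and $\|S^*\rho\|_1=\|\rho\|_1$. Moreover $S^*$ is an $L^1$ contraction, i.e. $\|S^*\rho\|_1\le\|\rho\|_1$ for all $\rho\in L^1(\mathbb{R}^d)$.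
   Context: $\|g\|_{C^m}:=\sum_{|\alpha|\le m}|D^\alpha g|_\infty$ (sup norms over $\mathbb{R}^d$). $\mathbb{E}$ is expectation over $\xi\sim\nu$, and $\sup_\xi$ is over all values of $\xi$. "$S$ is the dual of $S^*$" means $\int_{\mathbb{R}^d}(Su)\rho\,dx=\int_{\mathbb{R}^d}u\,(S^*\rho)\,dx$ for all $u\in L^\infty(\mathbb{R}^d)$, $\rho\in L^1(\mathbb{R}^d)$, using $(L^1)'=L^\infty$. *)

theory Defs
  imports "HOL-Probability.Probability"
begin

definition partial :: "'d::finite \<Rightarrow> (real^'d \<Rightarrow> real) \<Rightarrow> real^'d \<Rightarrow> real" where
  "partial i g x = frechet_derivative g (at x) (axis i 1)"

definition grad :: "(real^'d::finite \<Rightarrow> real) \<Rightarrow> real^'d \<Rightarrow> real^'d" where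
  "grad g x = (\<chi> i. partial i g x)"

definition hessian :: "(real^'d::finite \<Rightarrow> real) \<Rightarrow> real^'d \<Rightarrow> real^'d^'d" where
  "hessian g x = (\<chi> i j. partial i (partial j g) x)"

primrec Ck :: "nat \<Rightarrow> (real^'d::finite \<Rightarrow> real) \<Rightarrow> bool" where
  "Ck 0 g \<longleftrightarrow> continuous_on UNIV g"
| "Ck (Suc m) g \<longleftrightarrow> (\<forall>x. g differentiable (at x)) \<and> (\<forall>i. Ck m (partial i g))"

(* Multi-indices are functions 'd \<Rightarrow> nat. The order in which the partial derivatives are taken
   is an arbitrary fixed enumeration of the coordinates; it does not matter when g is of class
   C^m and the multi-index has order at most m. *)
definition coords :: "'d::finite list" where
  "coords = (SOME is. distinct is \<and> set is = UNIV)"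

definition multi_deriv :: "('d::finite \<Rightarrow> nat) \<Rightarrow> (real^'d \<Rightarrow> real) \<Rightarrow> real^'d \<Rightarrow> real" where
  "multi_deriv \<alpha> g = foldr (\<lambda>i. partial i ^^ \<alpha> i) coords g"

definition sup_norm :: "('a \<Rightarrow> real) \<Rightarrow> ennreal" where
  "sup_norm g = (SUP x. ennreal \<bar>g x\<bar>)"

definition Ck_norm :: "nat \<Rightarrow> (real^'d::finite \<Rightarrow> real) \<Rightarrow> ennreal" where
  "Ck_norm m g = (\<Sum>\<alpha> | (\<Sum>i\<in>UNIV. \<alpha> i) \<le> m. sup_norm (multi_deriv \<alpha> g))"

text \<open>The index set of the sum in \<open>Ck_norm\<close> is finite, so that the sum is not the default value 0.\<close>

lemma finite_multi_indices: "finite {\<alpha> :: 'd::finite \<Rightarrow> nat. (\<Sum>i\<in>UNIV. \<alpha> i) \<le> m}"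
proof (rule finite_subset)
  show "{\<alpha> :: 'd \<Rightarrow> nat. (\<Sum>i\<in>UNIV. \<alpha> i) \<le> m} \<subseteq> Pi\<^sub>E UNIV (\<lambda>_. {..m})"
  proof
    fix \<alpha> :: "'d \<Rightarrow> nat"
    assume "\<alpha> \<in> {\<alpha>. (\<Sum>i\<in>UNIV. \<alpha> i) \<le> m}"
    moreover have "\<alpha> j \<le> (\<Sum>i\<in>UNIV. \<alpha> i)" for j
      by (rule member_le_sum) auto
    ultimately show "\<alpha> \<in> Pi\<^sub>E UNIV (\<lambda>_. {..m})"
      by (auto intro: order_trans)
  qed
qed (auto intro: finite_PiE)

(* Elements of L^1 and L^\<infinity> are represented by Borel functions; equality in these spaces is
   equality almost everywhere. *)
definition L1 :: "(real^'d::finite \<Rightarrow> real) set" where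
  "L1 = {\<rho>. integrable lborel \<rho>}"

definition L1_norm :: "(real^'d::finite \<Rightarrow> real) \<Rightarrow> real" where
  "L1_norm \<rho> = (\<integral>x. \<bar>\<rho> x\<bar> \<partial>lborel)"

definition Linf :: "(real^'d::finite \<Rightarrow> real) set" where
  "Linf = {u. u \<in> borel_measurable lborel \<and> (\<exists>C. AE x in lborel. \<bar>u x\<bar> \<le> C)}"

definition maps_classes ::
  "((real^'d::finite \<Rightarrow> real) \<Rightarrow> (real^'d \<Rightarrow> real)) \<Rightarrow>
   (real^'d \<Rightarrow> real) set \<Rightarrow> (real^'d \<Rightarrow> real) set \<Rightarrow> bool" where
  "maps_classes T A B \<longleftrightarrow> (\<forall>u\<in>A. T u \<in> B) \<and>
     (\<forall>u\<in>A. \<forall>v\<in>A. (AE x in lborel. u x = v x) \<longrightarrow> (AE x in lborel. T u x = T v x))"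

definition is_dual_of ::
  "((real^'d::finite \<Rightarrow> real) \<Rightarrow> (real^'d \<Rightarrow> real)) \<Rightarrow>
   ((real^'d \<Rightarrow> real) \<Rightarrow> (real^'d \<Rightarrow> real)) \<Rightarrow> bool" where
  "is_dual_of S Sstar \<longleftrightarrow> (\<forall>u\<in>Linf. \<forall>\<rho>\<in>L1.
     (\<integral>x. S u x * \<rho> x \<partial>lborel) = (\<integral>x. u x * Sstar \<rho> x \<partial>lborel))"

definition grad_step :: "real \<Rightarrow> (real^'d::finite \<Rightarrow> real) \<Rightarrow> real^'d \<Rightarrow> real^'d" where
  "grad_step \<eta> g x = x - \<eta> *\<^sub>R grad g x"

definition step_det :: "real \<Rightarrow> (real^'d::finite \<Rightarrow> real) \<Rightarrow> real^'d \<Rightarrow> real" where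
  "step_det \<eta> g x = det (mat 1 - \<eta> *\<^sub>R hessian g x)"

definition S_op ::
  "'k measure \<Rightarrow> ('k \<Rightarrow> real^'d::finite \<Rightarrow> real) \<Rightarrow> real \<Rightarrow>
   (real^'d \<Rightarrow> real) \<Rightarrow> real^'d \<Rightarrow> real" where
  "S_op \<nu> f \<eta> u x = (\<integral>\<xi>. u (grad_step \<eta> (f \<xi>) x) \<partial>\<nu>)"

end

theory Submission imports Defs begin

text \<open>
  Write \<open>\<Phi> \<xi> = grad_step \<eta> (f \<xi>)\<close>. The \<open>C\<^sup>2\<close> bound makes all second partial derivatives of
  all \<open>f \<xi>\<close> bounded by one constant \<open>M\<close>, hence all gradients Lipschitz with the constant
  \<open>L = d\<^sup>2 M\<close>. As soon as \<open>\<eta> L < 1\<close>, each \<open>\<Phi> \<xi>\<close> is the identity minus a contraction: it is a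
  bijection of the whole space (\<open>bij_grad_step\<close>) whose derivative is injective everywhere
  (\<open>step_det_nonzero\<close>). The bound in \<open>Ck_norm\<close> sees each mixed derivative in one order only,
  so this step rests on the symmetry of second derivatives (\<open>mixed_partials_commute\<close>).

  Let \<open>h \<xi>\<close> be the inverse of \<open>\<Phi> \<xi>\<close> and \<open>w \<xi> = 1 / \<bar>det D\<Phi> \<xi>\<bar> \<circ> h \<xi>\<close> its Jacobian
  determinant. The change of variables formula (\<open>nn_integral_change_of_variables\<close>) says that the image of the measure
  \<open>w \<xi> dx\<close> under \<open>h \<xi>\<close> is Lebesgue measure. For fixed \<open>\<xi>\<close> this gives
  \<open>\<integral> u(\<Phi> \<xi> z) \<rho>(z) dz = \<integral> u(x) \<rho>(h \<xi> x) w \<xi> x dx\<close> (\<open>dual_pairing_section\<close>), and taking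
  expectations and exchanging the integrals on both sides is the duality. Fubini's theorem
  applies because the integrals over \<open>x\<close> of the absolute values are bounded uniformly in \<open>\<xi>\<close>.
  It requires measurability of \<open>\<Phi>\<close>, \<open>h\<close> and \<open>w\<close> in both variables together, while
  \<open>f\<close> is only known to be measurable in \<open>\<xi>\<close> and smooth in \<open>x\<close>; functions of this kind are
  jointly measurable (\<open>borel_measurable_caratheodory\<close>), and \<open>h\<close> is a limit of fixed-point iterates.

  The remaining claims are formal. Conservation of the integral is duality against \<open>u = 1\<close>.
  The dual operator preserves nonnegativity since \<open>w > 0\<close>, so it preserves the norm of
  nonnegative functions, and the contraction property follows from
  \<open>\<bar>S\<^sup>* \<rho>\<bar> \<le> S\<^sup>* \<bar>\<rho>\<bar>\<close>. All of this uses the maps only through measurability and the identities above,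
  which is why it is carried out in the locale \<open>random_diffeomorphism\<close>.
\<close>

section \<open>Change of variables over an arbitrary finite index type\<close>

text \<open>The formula for the volume of a differentiable image, \<open>has_measure_differentiable_image\<close>,
  speaks about vectors whose index type is well-ordered. A copy of a finite type, ordered by some
  numbering of its elements, meets this requirement; volumes and determinants do not depend on
  how the coordinates are named, so the formula carries over to the original type.\<close>

datatype 'a ranked = Ranked (unranked: 'a)

definition rank_of :: "'a::finite \<Rightarrow> nat" where
  "rank_of = (SOME r. inj r)"

lemma inj_rank_of: "inj (rank_of :: 'a::finite \<Rightarrow> nat)"
proof -
  obtain r :: "'a \<Rightarrow> nat" where "inj r"
    using finite_imp_inj_to_nat_seg[OF finite[of "UNIV :: 'a set"]] by blast
  then show ?thesis
    unfolding rank_of_def by (rule someI[of inj])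
qed

lemma bij_unranked: "bij unranked"
  by (rule bijI') (auto simp: ranked.expand, metis ranked.sel)

instance ranked :: (finite) finite
proof
  show "finite (UNIV :: 'a ranked set)"
    using bij_unranked bij_betw_finite finite by blast
qed

instantiation ranked :: (finite) linorder
begin

definition "x \<le> y \<longleftrightarrow> rank_of (unranked x) \<le> rank_of (unranked y)"
definition "x < y \<longleftrightarrow> rank_of (unranked x) < rank_of (unranked y)"

instance
  by standard
    (auto simp: less_eq_ranked_def less_ranked_def ranked.expand injD[OF inj_rank_of])

end

instance ranked :: (finite) wellorder
proof
  fix P :: "'a ranked \<Rightarrow> bool" and a
  assume step: "\<And>x. (\<And>y. y < x \<Longrightarrow> P y) \<Longrightarrow> P x"
  show "P a"
    by (induction a rule: measure_induct_rule[of "\<lambda>x. rank_of (unranked x)"])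
      (rule step, simp add: less_ranked_def)
qed

text \<open>Conjugation by \<open>\<sigma>\<close> matches the permutations of the two index types and preserves signs, hence
  matches the Leibniz expansions term by term.\<close>

lemma det_reindex:
  fixes A :: "real^'n^'n" and \<sigma> :: "'m::finite \<Rightarrow> 'n::finite"
  assumes \<sigma>: "bij \<sigma>"
  shows "det (\<chi> i j. A $ \<sigma> i $ \<sigma> j) = det A"
proof -
  have inj: "inj \<sigma>" and surj: "surj \<sigma>"
    using \<sigma> by (auto simp: bij_def)
  define m where "m = map_permutation UNIV \<sigma>"
  have m_apply: "m p (\<sigma> i) = \<sigma> (p i)" for p i
    using inj surj by (simp add: m_def map_permutation_def restrict_id_def)
  have bij_m: "bij_betw m {p. p permutes UNIV} {p. p permutes UNIV}"
  proof (rule bij_betw_byWitness[where f' = "map_permutation UNIV (inv \<sigma>)"])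
    show "m ` {p. p permutes UNIV} \<subseteq> {p. p permutes UNIV}"
      using \<sigma> map_permutation_permutes[of \<sigma> UNIV UNIV] by (auto simp: m_def)
    show "map_permutation UNIV (inv \<sigma>) ` {p. p permutes UNIV} \<subseteq> {p. p permutes UNIV}"
      using bij_imp_bij_inv[OF \<sigma>] map_permutation_permutes[of "inv \<sigma>" UNIV UNIV]
      by auto
    show "\<forall>p\<in>{p. p permutes UNIV}. map_permutation UNIV (inv \<sigma>) (m p) = p"
      using inj surj bij_imp_bij_inv[OF \<sigma>] 
      by (auto simp: m_def map_permutation_def restrict_id_def fun_eq_iff bij_def inv_inv_eq[OF \<sigma>])
    show "\<forall>p\<in>{p. p permutes UNIV}. m (map_permutation UNIV (inv \<sigma>) p) = p"
      using inj surj bij_imp_bij_inv[OF \<sigma>] 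
      by (auto simp: m_def map_permutation_def restrict_id_def fun_eq_iff bij_def inv_inv_eq[OF \<sigma>] surj_f_inv_f)
  qed
  have "det A = (\<Sum>p | p permutes UNIV. of_int (sign (m p)) * (\<Prod>i\<in>UNIV. A $ i $ m p i))"
    unfolding det_def by (rule sum.reindex_bij_betw[OF bij_m, symmetric])
  also have "\<dots> = (\<Sum>p | p permutes UNIV. of_int (sign p) * (\<Prod>i\<in>UNIV. A $ \<sigma> i $ \<sigma> (p i)))"
  proof (rule sum.cong[OF refl])
    fix p :: "'m \<Rightarrow> 'm"
    assume "p \<in> {p. p permutes UNIV}"
    then have "sign (m p) = sign p"
      unfolding m_def using sign_map_permutation[OF inj] by auto
    moreover have "(\<Prod>i\<in>UNIV. A $ i $ m p i) = (\<Prod>i\<in>UNIV. A $ \<sigma> i $ \<sigma> (p i))"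
      using prod.reindex_bij_betw[OF \<sigma>, of "\<lambda>i. A $ i $ m p i"] by (simp add: m_apply)
    ultimately show "of_int (sign (m p)) * (\<Prod>i\<in>UNIV. A $ i $ m p i) =
        of_int (sign p) * (\<Prod>i\<in>UNIV. A $ \<sigma> i $ \<sigma> (p i))"
      by simp
  qed
  also have "\<dots> = det (\<chi> i j. A $ \<sigma> i $ \<sigma> j)"
    by (simp add: det_def)
  finally show ?thesis by simp
qed

lemma linear_reindex: "linear (\<lambda>y :: real^'n. \<chi> i. y $ \<sigma> i)"
  by (rule linearI) (auto simp: vec_eq_iff)

lemma prod_Basis_vec:
  fixes F :: "real^'n \<Rightarrow> real"
  shows "(\<Prod>b\<in>Basis. F b) = (\<Prod>i\<in>UNIV. F (axis i 1))"
proof -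
  have "bij_betw (\<lambda>i :: 'n. axis i (1::real)) UNIV Basis"
    by (auto simp: bij_betw_def Basis_vec_def axis_eq_axis intro!: injI)
  from prod.reindex_bij_betw[OF this, of F] show ?thesis by simp
qed

text \<open>Renaming coordinates turns a box into the box with renamed side lengths, whose volume is the same
  product in another order; Lebesgue measure is determined by the boxes.\<close>

lemma lborel_reindex:
  fixes \<sigma> :: "'m::finite \<Rightarrow> 'n::finite"
  assumes \<sigma>: "bij \<sigma>"
  shows "distr lborel borel (\<lambda>y :: real^'n. (\<chi> i. y $ \<sigma> i) :: real^'m) = lborel"
proof (rule lborel_eqI[symmetric])
  fix l u :: "real^'m"
  assume le: "\<And>b. b \<in> Basis \<Longrightarrow> l \<bullet> b \<le> u \<bullet> b"
  let ?T = "\<lambda>y :: real^'n. (\<chi> i. y $ \<sigma> i) :: real^'m"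
  have T: "?T \<in> borel \<rightarrow>\<^sub>M borel"
    by (intro borel_measurable_continuous_onI linear_continuous_on linear_linear[THEN iffD2] linear_reindex)
  define l' u' :: "real^'n" where "l' = (\<chi> k. l $ inv \<sigma> k)" and "u' = (\<chi> k. u $ inv \<sigma> k)"
  have inv: "inv \<sigma> (\<sigma> i) = i" "\<sigma> (inv \<sigma> k) = k" for i k
    using \<sigma> by (auto simp: bij_def surj_f_inv_f)
  have le': "l $ i \<le> u $ i" for i
    using le[of "axis i 1"] by (simp add: inner_axis axis_in_Basis_iff)
  have "?T -` box l u = box l' u'"
    by (auto simp: mem_box_cart l'_def u'_def) (metis inv)+
  then have "emeasure (distr lborel borel ?T) (box l u) = emeasure lborel (box l' u')"
    using T by (subst emeasure_distr) auto
  also have "\<dots> = ennreal (\<Prod>b\<in>Basis. (u' - l') \<bullet> b)"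
    using le' by (intro emeasure_lborel_box) (auto simp: Basis_vec_def inner_axis l'_def u'_def)
  also have "(\<Prod>b\<in>Basis. (u' - l') \<bullet> b) = (\<Prod>k\<in>UNIV. (u - l) $ inv \<sigma> k)"
    by (simp add: prod_Basis_vec inner_axis l'_def u'_def)
  also have "\<dots> = (\<Prod>i\<in>UNIV. (u - l) $ i)"
    using prod.reindex_bij_betw[OF bij_imp_bij_inv[OF \<sigma>], of "\<lambda>i. (u - l) $ i"] by simp
  also have "\<dots> = (\<Prod>b\<in>Basis. (u - l) \<bullet> b)"
    by (simp add: prod_Basis_vec inner_axis)
  finally show "emeasure (distr lborel borel ?T) (box l u) = (\<Prod>b\<in>Basis. (u - l) \<bullet> b)" .
qed simp

text \<open>The measure with density \<open>\<bar>det Dg\<bar>\<close>, pushed forward along \<open>g\<close>, is Lebesgue measure: it gives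
  a box \<open>B\<close> the volume of \<open>g ` (g -` B)\<close>, which is \<open>B\<close>. Starting from boxes in the range keeps all
  volumes finite without any bound on the derivative.\<close>

lemma nn_integral_change_of_variables_wellorder:
  fixes g :: "real^'n::{finite,wellorder} \<Rightarrow> real^'n::_"
  assumes g: "\<And>x. (g has_derivative g' x) (at x)"
    and bij: "bij g"
    and J: "(\<lambda>x. det (matrix (g' x))) \<in> borel_measurable borel"
    and p[measurable]: "p \<in> borel_measurable borel"
  shows "(\<integral>\<^sup>+x. p (g x) * ennreal \<bar>det (matrix (g' x))\<bar> \<partial>lborel) = (\<integral>\<^sup>+x. p x \<partial>lborel)"
proof -
  note J[measurable]
  have cont: "continuous_on UNIV g"
    using g has_derivative_continuous continuous_at_imp_continuous_on by blast
  then have [measurable]: "g \<in> borel \<rightarrow>\<^sub>M borel"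
    by (rule borel_measurable_continuous_onI)
  let ?D = "density lborel (\<lambda>x. ennreal \<bar>det (matrix (g' x))\<bar>)"
  have "lborel = distr ?D borel g"
  proof (rule lborel_eqI)
    fix l u :: "real^'n::_"
    assume le: "\<And>b. b \<in> Basis \<Longrightarrow> l \<bullet> b \<le> u \<bullet> b"
    let ?S = "g -` box l u"
    have S: "open ?S"
      by (rule open_vimage[OF open_box cont])
    have [measurable]: "?S \<in> sets borel"
      using S by simp
    have image: "g ` ?S = box l u"
      using bij by (auto simp: bij_def surj_image_vimage_eq)
    have "((\<lambda>x. \<bar>det (matrix (g' x))\<bar>) has_integral measure lebesgue (box l u)) ?S"
    proof (subst has_measure_differentiable_image[symmetric])
      show "?S \<in> sets lebesgue"
        by (simp add: S borel_open)
      show "\<And>x. x \<in> ?S \<Longrightarrow> (g has_derivative g' x) (at x within ?S)"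
        using g has_derivative_at_withinI by blast
      show "inj_on g ?S"
        using bij by (auto simp: bij_def intro: inj_on_subset)
      show "g ` ?S \<in> lmeasurable \<and> measure lebesgue (g ` ?S) = measure lebesgue (box l u)"
        unfolding image by simp
    qed
    then have "(\<integral>\<^sup>+x. indicator ?S x * \<bar>det (matrix (g' x))\<bar> \<partial>lborel) = measure lebesgue (box l u)"
      by (intro nn_integral_has_integral_lebesgue) auto
    moreover have "emeasure (distr ?D borel g) (box l u) =
        (\<integral>\<^sup>+x. indicator ?S x * \<bar>det (matrix (g' x))\<bar> \<partial>lborel)"
      by (subst emeasure_distr) (auto simp: emeasure_density indicator_def ennreal_mult intro!: nn_integral_cong)
    ultimately show "emeasure (distr ?D borel g) (box l u) = (\<Prod>b\<in>Basis. (u - l) \<bullet> b)"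
      using le by (simp add: measure_lborel_box_eq)
  qed simp
  then have "(\<integral>\<^sup>+x. p x \<partial>lborel) = (\<integral>\<^sup>+x. p x \<partial>distr ?D borel g)"
    by simp
  also have "\<dots> = (\<integral>\<^sup>+x. p (g x) * ennreal \<bar>det (matrix (g' x))\<bar> \<partial>lborel)"
    by (simp add: nn_integral_distr nn_integral_density mult.commute)
  finally show ?thesis by simp
qed

text \<open>Conjugating \<open>g\<close> by the renaming \<open>T\<close> of coordinates changes neither Lebesgue measure nor the
  Jacobian determinant.\<close>

lemma nn_integral_change_of_variables:
  fixes g :: "real^'n::finite \<Rightarrow> real^'n"
  assumes g: "\<And>x. (g has_derivative g' x) (at x)"
    and bij: "bij g"
    and J: "(\<lambda>x. det (matrix (g' x))) \<in> borel_measurable borel"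
    and p: "p \<in> borel_measurable borel"
  shows "(\<integral>\<^sup>+x. p (g x) * ennreal \<bar>det (matrix (g' x))\<bar> \<partial>lborel) = (\<integral>\<^sup>+x. p x \<partial>lborel)"
proof -
  note J[measurable] p[measurable]
  define T :: "real^'n ranked \<Rightarrow> real^'n" where "T = (\<lambda>y. \<chi> i. y $ Ranked i)"
  define T' :: "real^'n \<Rightarrow> real^'n ranked" where "T' = (\<lambda>x. \<chi> k. x $ unranked k)"
  have TT': "T (T' x) = x" "T' (T y) = y" for x y
    by (simp_all add: T_def T'_def vec_eq_iff)
  have bij_T: "bij T" "bij T'"
    using TT' by (metis bijI')+
  have "linear T" "linear T'"
    unfolding T_def T'_def by (rule linear_reindex)+
  then have lin: "bounded_linear T" "bounded_linear T'"
    by (simp_all add: linear_linear)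
  have [measurable]: "T \<in> borel \<rightarrow>\<^sub>M borel"
    by (intro borel_measurable_continuous_onI linear_continuous_on lin)
  have [measurable]: "g \<in> borel \<rightarrow>\<^sub>M borel"
    using g has_derivative_continuous continuous_at_imp_continuous_on
    by (intro borel_measurable_continuous_onI) blast
  have "bij (Ranked :: 'n \<Rightarrow> _)"
    by (rule bijI') (auto, metis ranked.exhaust)
  then have distr_T: "distr lborel borel T = lborel"
    unfolding T_def by (rule lborel_reindex)
  define G where "G = T' \<circ> g \<circ> T"
  define G' where "G' y = T' \<circ> g' (T y) \<circ> T" for y
  have TG: "T (G y) = g (T y)" for y
    by (simp add: G_def TT')
  have G: "(G has_derivative G' y) (at y)" for y
    unfolding G_def G'_def
    by (intro diff_chain_at bounded_linear_imp_has_derivative lin g)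
  have "bij G"
    unfolding G_def by (intro bij_comp bij bij_T)
  have T_axis: "T (axis k 1) = axis (unranked k) 1" for k
    by (auto simp: T_def axis_def vec_eq_iff)
  have "matrix (G' y) = (\<chi> i j. matrix (g' (T y)) $ unranked i $ unranked j)" for y
    by (simp add: matrix_def G'_def T_axis vec_eq_iff) (simp add: T'_def)
  then have det_G: "det (matrix (G' y)) = det (matrix (g' (T y)))" for y
    by (simp add: det_reindex[OF bij_unranked])
  have "(\<integral>\<^sup>+x. p (g x) * ennreal \<bar>det (matrix (g' x))\<bar> \<partial>lborel) =
      (\<integral>\<^sup>+x. p (g x) * ennreal \<bar>det (matrix (g' x))\<bar> \<partial>distr lborel borel T)"
    by (simp add: distr_T)
  also have "\<dots> = (\<integral>\<^sup>+y. p (T (G y)) * ennreal \<bar>det (matrix (G' y))\<bar> \<partial>lborel)"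
    by (subst nn_integral_distr) (simp_all add: TG det_G)
  also have "\<dots> = (\<integral>\<^sup>+y. p (T y) \<partial>lborel)"
    by (rule nn_integral_change_of_variables_wellorder[OF G \<open>bij G\<close>]) (simp_all add: det_G)
  also have "\<dots> = (\<integral>\<^sup>+x. p x \<partial>distr lborel borel T)"
    by (subst nn_integral_distr) simp_all
  finally show ?thesis
    by (simp add: distr_T)
qed

section \<open>Joint measurability of functions continuous in one variable\<close>

text \<open>Rounding \<open>x\<close> down to a grid of mesh \<open>1 / (n + 1)\<close> leaves countably many values of \<open>x\<close>, and for
  each of them \<open>F\<close> is measurable in \<open>\<xi>\<close>. By continuity in \<open>x\<close>, \<open>F\<close> is the pointwise limit of these
  roundings.\<close>

lemma borel_measurable_caratheodory:
  fixes F :: "'k \<Rightarrow> real^'d::finite \<Rightarrow> 'b::metric_space"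
  assumes meas: "\<And>x. (\<lambda>\<xi>. F \<xi> x) \<in> borel_measurable M"
    and cont: "\<And>\<xi>. \<xi> \<in> space M \<Longrightarrow> continuous_on UNIV (F \<xi>)"
  shows "(\<lambda>(\<xi>, x). F \<xi> x) \<in> borel_measurable (M \<Otimes>\<^sub>M borel)"
proof -
  define cell :: "nat \<Rightarrow> real^'d \<Rightarrow> int^'d" where
    "cell n x = (\<chi> i. \<lfloor>real (Suc n) * x $ i\<rfloor>)" for n x
  define corner :: "nat \<Rightarrow> int^'d \<Rightarrow> real^'d" where
    "corner n z = (\<chi> i. real_of_int (z $ i) / real (Suc n))" for n z
  have cell: "cell n \<in> borel \<rightarrow>\<^sub>M count_space UNIV" for n
    unfolding measurable_count_space_eq2_countable
  proof safe
    fix z :: "int^'d"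
    have "cell n -` {z} \<inter> space borel = (\<Inter>i. {x \<in> space borel. \<lfloor>real (Suc n) * x $ i\<rfloor> = z $ i})"
      by (auto simp: cell_def vec_eq_iff)
    also have "\<dots> \<in> sets borel"
      by measurable
    finally show "cell n -` {z} \<inter> space borel \<in> sets borel" .
  qed simp
  show ?thesis
  proof (rule borel_measurable_LIMSEQ_metric)
    fix n
    have "(\<lambda>p. (\<lambda>z p. F (fst p) (corner n z)) (cell n (snd p)) p) \<in> borel_measurable (M \<Otimes>\<^sub>M borel)"
    proof (rule measurable_compose_countable)
      show "(\<lambda>p. F (fst p) (corner n z)) \<in> borel_measurable (M \<Otimes>\<^sub>M borel)" for z
        using measurable_compose[OF measurable_fst meas] .
      show "(\<lambda>p. cell n (snd p)) \<in> M \<Otimes>\<^sub>M borel \<rightarrow>\<^sub>M count_space UNIV"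
        using measurable_compose[OF measurable_snd cell] .
    qed
    then show "(\<lambda>(\<xi>, x). F \<xi> (corner n (cell n x))) \<in> borel_measurable (M \<Otimes>\<^sub>M borel)"
      by (simp add: case_prod_beta')
  next
    fix p :: "'k \<times> (real^'d)"
    assume "p \<in> space (M \<Otimes>\<^sub>M borel)"
    then obtain \<xi> x where p: "p = (\<xi>, x)" "\<xi> \<in> space M"
      by (auto simp: space_pair_measure)
    have "(\<lambda>n. corner n (cell n x)) \<longlonglongrightarrow> x"
    proof (rule vec_tendstoI)
      fix i
      have lower: "x $ i - 1 / real (Suc n) \<le> corner n (cell n x) $ i" for n
      proof -
        have "x $ i - 1 / real (Suc n) = (real (Suc n) * x $ i - 1) / real (Suc n)"
          by (simp add: diff_divide_distrib del: of_nat_Suc)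
        also have "\<dots> \<le> \<lfloor>real (Suc n) * x $ i\<rfloor> / real (Suc n)"
          by (intro divide_right_mono) linarith+
        finally show ?thesis
          by (simp add: corner_def cell_def)
      qed
      have upper: "corner n (cell n x) $ i \<le> x $ i" for n
        using floor_correct[of "real (Suc n) * x $ i"]
        by (simp add: corner_def cell_def field_simps del: of_nat_Suc)
      have "(\<lambda>n. x $ i - 1 / real (Suc n)) \<longlonglongrightarrow> x $ i - 0"
        by (intro tendsto_intros LIMSEQ_inverse_real_of_nat[unfolded inverse_eq_divide])
      then have "(\<lambda>n. x $ i - 1 / real (Suc n)) \<longlonglongrightarrow> x $ i"
        by (simp only: diff_zero)
      then show "(\<lambda>n. corner n (cell n x) $ i) \<longlonglongrightarrow> x $ i"
        by (rule real_tendsto_sandwich[OF always_eventually always_eventually _ tendsto_const, rotated 2])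
          (use lower upper in blast)+
    qed
    then have "(\<lambda>n. F \<xi> (corner n (cell n x))) \<longlonglongrightarrow> F \<xi> x"
      using cont[OF p(2)] isCont_tendsto_compose[of x "F \<xi>"]
      by (simp add: continuous_on_eq_continuous_at)
    then show "(\<lambda>n. case p of (\<xi>, x) \<Rightarrow> F \<xi> (corner n (cell n x))) \<longlonglongrightarrow> (case p of (\<xi>, x) \<Rightarrow> F \<xi> x)"
      by (simp add: p)
  qed
qed

section \<open>Second partial derivatives and the \<open>C\<^sup>2\<close> norm\<close>

lemma Ck_2D:
  assumes "Ck 2 g"
  shows "g differentiable (at x)" "partial i g differentiable (at x)"
    "continuous_on UNIV (partial j (partial i g))"
  using assms by (simp_all add: numeral_2_eq_2)

lemma has_derivative_partial:
  fixes g :: "real^'d::finite \<Rightarrow> real"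
  assumes "g differentiable (at x)"
  shows "(g has_derivative (\<lambda>v. \<Sum>i\<in>UNIV. v $ i * partial i g x)) (at x)"
proof -
  have D: "(g has_derivative frechet_derivative g (at x)) (at x)"
    using assms frechet_derivative_works by blast
  then have lin: "linear (frechet_derivative g (at x))"
    by (rule has_derivative_linear)
  have "frechet_derivative g (at x) v = (\<Sum>i\<in>UNIV. v $ i * partial i g x)" for v
  proof -
    have "frechet_derivative g (at x) v = frechet_derivative g (at x) (\<Sum>i\<in>UNIV. v $ i *\<^sub>R axis i 1)"
      using basis_expansion[of v] by (simp add: scalar_mult_eq_scaleR)
    also have "\<dots> = (\<Sum>i\<in>UNIV. v $ i * partial i g x)"
      by (simp add: linear_sum[OF lin] linear_cmul[OF lin] partial_def)
    finally show ?thesis .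
  qed
  with D show ?thesis by (metis (no_types, lifting) ext)
qed

lemma DERIV_partial:
  fixes g :: "real^'d::finite \<Rightarrow> real"
  assumes "\<And>x. g differentiable (at x)"
  shows "((\<lambda>t. g (y + t *\<^sub>R axis i 1)) has_real_derivative partial i g (y + t *\<^sub>R axis i 1)) (at t)"
proof -
  have "((\<lambda>t. g (y + t *\<^sub>R axis i 1)) has_derivative
      (\<lambda>s. \<Sum>k\<in>UNIV. (s *\<^sub>R axis i 1 :: real^'d) $ k * partial k g (y + t *\<^sub>R axis i 1))) (at t)"
    by (rule has_derivative_compose[OF _ has_derivative_partial[OF assms]])
      (auto intro!: derivative_eq_intros)
  moreover have "(\<Sum>k\<in>UNIV. (s *\<^sub>R axis i 1 :: real^'d) $ k * partial k g z) = partial i g z * s" for s z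
    by (simp add: axis_def if_distrib if_distribR sum.delta cong: if_cong)
  ultimately show ?thesis
    by (simp add: has_field_derivative_def)
qed

text \<open>Two applications of the mean value theorem, in direction \<open>i\<close> to a difference in direction \<open>j\<close> and
  then in direction \<open>j\<close>. The left-hand side is symmetric in \<open>i\<close> and \<open>j\<close>, which is the point of the lemma.\<close>

lemma second_difference_eq_mixed_partial:
  fixes g :: "real^'d::finite \<Rightarrow> real"
  assumes g: "Ck 2 g" and s: "s > 0"
  shows "\<exists>a b. 0 < a \<and> a < s \<and> 0 < b \<and> b < s \<and>
    g (x + s *\<^sub>R axis i 1 + s *\<^sub>R axis j 1) - g (x + s *\<^sub>R axis i 1) - g (x + s *\<^sub>R axis j 1) + g x
    = s\<^sup>2 * partial j (partial i g) (x + a *\<^sub>R axis i 1 + b *\<^sub>R axis j 1)"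
proof -
  let ?e = "axis i 1 :: real^'d" and ?f = "axis j 1 :: real^'d"
  note D = DERIV_partial[OF Ck_2D(1)[OF g]] and DD = DERIV_partial[OF Ck_2D(2)[OF g]]
  define \<phi> where "\<phi> t = g ((x + s *\<^sub>R ?f) + t *\<^sub>R ?e) - g (x + t *\<^sub>R ?e)" for t
  have "\<exists>a>0. a < s \<and> \<phi> s - \<phi> 0 =
      (s - 0) * (partial i g ((x + s *\<^sub>R ?f) + a *\<^sub>R ?e) - partial i g (x + a *\<^sub>R ?e))"
    unfolding \<phi>_def by (intro MVT2 s DERIV_diff D)
  then obtain a where a: "0 < a" "a < s"
    and \<phi>: "\<phi> s - \<phi> 0 = s * (partial i g ((x + s *\<^sub>R ?f) + a *\<^sub>R ?e) - partial i g (x + a *\<^sub>R ?e))"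
    by auto
  have "\<exists>b>0. b < s \<and> partial i g ((x + a *\<^sub>R ?e) + s *\<^sub>R ?f) - partial i g ((x + a *\<^sub>R ?e) + 0 *\<^sub>R ?f) =
      (s - 0) * partial j (partial i g) ((x + a *\<^sub>R ?e) + b *\<^sub>R ?f)"
    by (intro MVT2[where f = "\<lambda>t. partial i g ((x + a *\<^sub>R ?e) + t *\<^sub>R ?f)"] s DD)
  then obtain b where b: "0 < b" "b < s"
    and psi: "partial i g (x + a *\<^sub>R ?e + s *\<^sub>R ?f) - partial i g (x + a *\<^sub>R ?e) =
      s * partial j (partial i g) (x + a *\<^sub>R ?e + b *\<^sub>R ?f)"
    by auto
  have comm: "x + s *\<^sub>R ?f + t *\<^sub>R ?e = x + t *\<^sub>R ?e + s *\<^sub>R ?f" for t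
    by (simp add: add_ac)
  have "\<phi> s - \<phi> 0 = s * (s * partial j (partial i g) (x + a *\<^sub>R ?e + b *\<^sub>R ?f))"
    unfolding \<phi> comm psi ..
  moreover have "\<phi> s - \<phi> 0 = g (x + s *\<^sub>R ?e + s *\<^sub>R ?f) - g (x + s *\<^sub>R ?e) - g (x + s *\<^sub>R ?f) + g x"
    by (simp add: \<phi>_def comm)
  ultimately show ?thesis
    using a b by (intro exI[of _ a] exI[of _ b]) (simp add: power2_eq_square)
qed

text \<open>The same second difference equals \<open>s\<^sup>2\<close> times either mixed derivative, each taken at a point within
  \<open>2 s\<close> of \<open>x\<close>; for small \<open>s\<close>, continuity brings both mixed derivatives arbitrarily close together.\<close>

lemma mixed_partials_commute:
  fixes g :: "real^'d::finite \<Rightarrow> real"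
  assumes g: "Ck 2 g"
  shows "partial i (partial j g) x = partial j (partial i g) x"
proof (rule ccontr)
  let ?P = "partial j (partial i g)" and ?Q = "partial i (partial j g)"
  assume "?Q x \<noteq> ?P x"
  define \<epsilon> where "\<epsilon> = dist (?Q x) (?P x) / 2"
  have "\<epsilon> > 0"
    using \<open>?Q x \<noteq> ?P x\<close> by (simp add: \<epsilon>_def)
  obtain \<delta>1 where \<delta>1: "\<delta>1 > 0" "\<And>y. dist y x < \<delta>1 \<Longrightarrow> dist (?P y) (?P x) < \<epsilon>"
    using Ck_2D(3)[OF g] \<open>\<epsilon> > 0\<close> unfolding continuous_on_iff by (metis UNIV_I)
  obtain \<delta>2 where \<delta>2: "\<delta>2 > 0" "\<And>y. dist y x < \<delta>2 \<Longrightarrow> dist (?Q y) (?Q x) < \<epsilon>"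
    using Ck_2D(3)[OF g] \<open>\<epsilon> > 0\<close> unfolding continuous_on_iff by (metis UNIV_I)
  \<comment> \<open>Both intermediate points lie within \<open>2 s\<close> of \<open>x\<close>.\<close>
  define s where "s = min \<delta>1 \<delta>2 / 2"
  have s: "s > 0"
    using \<delta>1(1) \<delta>2(1) by (simp add: s_def)
  have near: "dist (x + a *\<^sub>R axis k 1 + b *\<^sub>R axis l 1) x < min \<delta>1 \<delta>2"
    if "0 < a" "a < s" "0 < b" "b < s" for a b and k l :: 'd
  proof -
    have "dist (x + a *\<^sub>R axis k 1 + b *\<^sub>R axis l 1) x = norm (a *\<^sub>R axis k 1 + b *\<^sub>R axis l 1 :: real^'d)"
      by (simp add: dist_norm add.assoc)
    also have "\<dots> \<le> a + b"
      using norm_triangle_ineq[of "a *\<^sub>R axis k 1 :: real^'d" "b *\<^sub>R axis l 1"] that by simp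
    finally show ?thesis
      using that by (simp add: s_def)
  qed
  obtain a b where ab: "0 < a" "a < s" "0 < b" "b < s" and P:
    "g (x + s *\<^sub>R axis i 1 + s *\<^sub>R axis j 1) - g (x + s *\<^sub>R axis i 1) - g (x + s *\<^sub>R axis j 1) + g x
    = s\<^sup>2 * ?P (x + a *\<^sub>R axis i 1 + b *\<^sub>R axis j 1)"
    using second_difference_eq_mixed_partial[OF g s] by blast
  obtain c d where cd: "0 < c" "c < s" "0 < d" "d < s" and Q:
    "g (x + s *\<^sub>R axis j 1 + s *\<^sub>R axis i 1) - g (x + s *\<^sub>R axis j 1) - g (x + s *\<^sub>R axis i 1) + g x
    = s\<^sup>2 * ?Q (x + c *\<^sub>R axis j 1 + d *\<^sub>R axis i 1)"
    using second_difference_eq_mixed_partial[OF g s] by blast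
  have comm: "x + s *\<^sub>R axis j 1 + s *\<^sub>R axis i 1 = x + s *\<^sub>R axis i 1 + s *\<^sub>R axis j 1"
    by (simp add: add_ac)
  have "s\<^sup>2 * ?P (x + a *\<^sub>R axis i 1 + b *\<^sub>R axis j 1) = s\<^sup>2 * ?Q (x + c *\<^sub>R axis j 1 + d *\<^sub>R axis i 1)"
    using P Q unfolding comm by linarith
  then have "?P (x + a *\<^sub>R axis i 1 + b *\<^sub>R axis j 1) = ?Q (x + c *\<^sub>R axis j 1 + d *\<^sub>R axis i 1)"
    using s by simp
  moreover have "dist (?P (x + a *\<^sub>R axis i 1 + b *\<^sub>R axis j 1)) (?P x) < \<epsilon>"
    using near[OF ab] \<delta>1(2) by simp
  moreover have "dist (?Q (x + c *\<^sub>R axis j 1 + d *\<^sub>R axis i 1)) (?Q x) < \<epsilon>"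
    using near[OF cd] \<delta>2(2) by simp
  moreover have "dist (?Q x) (?P x) \<le> dist (?Q (x + c *\<^sub>R axis j 1 + d *\<^sub>R axis i 1)) (?Q x)
      + dist (?Q (x + c *\<^sub>R axis j 1 + d *\<^sub>R axis i 1)) (?P x)"
    by (rule dist_triangle3)
  ultimately show False
    by (simp add: \<epsilon>_def)
qed

lemma coords: "distinct (coords :: 'd::finite list)" "set (coords :: 'd list) = UNIV"
proof -
  have "\<exists>is :: 'd list. distinct is \<and> set is = UNIV"
    using finite_distinct_list[OF finite, of "UNIV :: 'd set"] by auto
  then have "distinct (coords :: 'd list) \<and> set (coords :: 'd list) = UNIV"
    unfolding coords_def by (rule someI_ex)
  then show "distinct (coords :: 'd list)" "set (coords :: 'd list) = UNIV" by auto
qed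

lemma foldr_partial_order_0:
  assumes "\<And>k. k \<in> set xs \<Longrightarrow> \<alpha> k = 0"
  shows "foldr (\<lambda>k. partial k ^^ \<alpha> k) xs g = g"
  using assms by (induction xs) auto

lemma foldr_partial_order_1:
  assumes "distinct xs" "j \<in> set xs" "\<And>k. k \<in> set xs \<Longrightarrow> \<alpha> k = of_bool (k = j)"
  shows "foldr (\<lambda>k. partial k ^^ \<alpha> k) xs g = partial j g"
  using assms
proof (induction xs)
  case (Cons a xs)
  show ?case
  proof (cases "a = j")
    case True
    then have "foldr (\<lambda>k. partial k ^^ \<alpha> k) xs g = g"
      using Cons.prems by (intro foldr_partial_order_0) auto
    then show ?thesis using True Cons.prems(3)[of a] by simp
  next
    case False
    then show ?thesis using Cons by auto
  qed
qed simp

text \<open>For the multi-index \<open>e\<^sub>i + e\<^sub>j\<close>, the order of the list decides which of the two derivatives is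
  taken first.\<close>

lemma foldr_partial_order_2:
  assumes "distinct xs" "i \<in> set xs" "j \<in> set xs"
    "\<And>k. k \<in> set xs \<Longrightarrow> \<alpha> k = of_bool (k = i) + of_bool (k = j)"
  shows "foldr (\<lambda>k. partial k ^^ \<alpha> k) xs g \<in> {partial i (partial j g), partial j (partial i g)}"
  using assms
proof (induction xs)
  case (Cons a xs)
  let ?F = "foldr (\<lambda>k. partial k ^^ \<alpha> k) xs g"
  consider "a = i" "a = j" | "a = i" "a \<noteq> j" | "a \<noteq> i" "a = j" | "a \<noteq> i" "a \<noteq> j" by blast
  then show ?case
  proof cases
    case 1
    then have "?F = g"
      using Cons.prems by (intro foldr_partial_order_0) auto
    then show ?thesis using 1 Cons.prems(4)[of a] by (simp add: numeral_2_eq_2)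
  next
    case 2
    then have "?F = partial j g"
      using Cons.prems by (intro foldr_partial_order_1) auto
    then show ?thesis using 2 Cons.prems(4)[of a] by simp
  next
    case 3
    then have "?F = partial i g"
      using Cons.prems by (intro foldr_partial_order_1) auto
    then show ?thesis using 3 Cons.prems(4)[of a] by simp
  next
    case 4
    then show ?thesis using Cons by auto
  qed
qed simp

text \<open>The norm contains the sup norm of one of the two mixed derivatives; by symmetry it bounds both.\<close>

lemma second_partial_le_Ck_norm:
  fixes g :: "real^'d::finite \<Rightarrow> real"
  assumes g: "Ck 2 g"
  shows "ennreal \<bar>partial i (partial j g) x\<bar> \<le> Ck_norm 2 g"
proof -
  define \<alpha> :: "'d \<Rightarrow> nat" where "\<alpha> k = of_bool (k = i) + of_bool (k = j)" for k
  have "multi_deriv \<alpha> g \<in> {partial i (partial j g), partial j (partial i g)}"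
    unfolding multi_deriv_def by (intro foldr_partial_order_2) (simp_all add: coords \<alpha>_def)
  then have "multi_deriv \<alpha> g x = partial i (partial j g) x"
    using mixed_partials_commute[OF g] by fastforce
  then have "ennreal \<bar>partial i (partial j g) x\<bar> \<le> sup_norm (multi_deriv \<alpha> g)"
    unfolding sup_norm_def by (intro SUP_upper2[of x]) auto
  also have "\<dots> \<le> Ck_norm 2 g"
    unfolding Ck_norm_def
    by (intro member_le_sum finite_multi_indices)
      (auto simp: \<alpha>_def sum.distrib of_bool_def sum.delta)
  finally show ?thesis .
qed

text \<open>The hessian has \<open>\<partial>\<^sub>i \<partial>\<^sub>j g\<close> in row \<open>i\<close> and column \<open>j\<close>, whereas the Jacobian matrix of the gradient
  has it in row \<open>j\<close> and column \<open>i\<close>; so the derivative multiplies the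
  row vector \<open>v\<close> by the hessian.\<close>

lemma has_derivative_grad:
  fixes g :: "real^'d::finite \<Rightarrow> real"
  assumes "Ck 2 g"
  shows "(grad g has_derivative (\<lambda>v. v v* hessian g x)) (at x)"
proof -
  have "((\<lambda>y. grad g y \<bullet> b) has_derivative (\<lambda>v. (v v* hessian g x) \<bullet> b)) (at x)"
    if "b \<in> Basis" for b
  proof -
    obtain j where b: "b = axis j 1"
      using \<open>b \<in> Basis\<close> by (auto simp: Basis_vec_def)
    show ?thesis
      using has_derivative_partial[OF Ck_2D(2)[OF assms], of j x]
      by (simp add: b inner_axis grad_def vector_matrix_mult_def hessian_def mult.commute)
  qed
  then show ?thesis
    by (subst has_derivative_componentwise_within) auto
qed

lemma norm_vector_matrix_mult_le:
  fixes H :: "real^'n^'n"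
  assumes "\<And>i j. \<bar>H $ i $ j\<bar> \<le> M"
  shows "norm (v v* H) \<le> (real CARD('n))\<^sup>2 * M * norm v"
proof -
  have "norm (v v* H) \<le> (\<Sum>j\<in>UNIV. \<bar>(v v* H) $ j\<bar>)"
    by (rule norm_le_l1_cart)
  also have "\<dots> \<le> (\<Sum>j\<in>(UNIV::'n set). \<Sum>i\<in>(UNIV::'n set). norm v * M)"
    unfolding vector_matrix_mult_def vec_lambda_beta
    by (intro sum_mono order_trans[OF sum_abs])
      (auto simp: abs_mult intro!: mult_mono assms component_le_norm_cart order_trans[OF abs_ge_zero assms])
  finally show ?thesis
    by (simp add: power2_eq_square mult_ac)
qed

lemma grad_lipschitz:
  fixes g :: "real^'d::finite \<Rightarrow> real"
  assumes g: "Ck 2 g" and M: "\<And>x i j. \<bar>partial i (partial j g) x\<bar> \<le> M"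
  shows "norm (grad g x - grad g y) \<le> (real CARD('d))\<^sup>2 * M * norm (x - y)"
proof (rule differentiable_bound[of UNIV])
  show "(grad g has_derivative (\<lambda>v. v v* hessian g x)) (at x within UNIV)" for x
    using has_derivative_grad[OF g] by simp
  show "onorm (\<lambda>v. v v* hessian g x) \<le> (real CARD('d))\<^sup>2 * M" for x
  proof (rule onorm_bound)
    show "0 \<le> (real CARD('d))\<^sup>2 * M"
      using order_trans[OF abs_ge_zero M] by simp
    show "norm (v v* hessian g x) \<le> (real CARD('d))\<^sup>2 * M * norm v" for v
      by (rule norm_vector_matrix_mult_le) (simp add: hessian_def M)
  qed
qed auto

section \<open>The gradient step as a perturbation of the identity\<close>

text \<open>The equation \<open>x - P x = y\<close> says that \<open>x\<close> is a fixed point of the contraction \<open>x \<mapsto> y + P x\<close>.\<close>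

lemma bij_minus_contraction:
  fixes P :: "'a::banach \<Rightarrow> 'a"
  assumes c: "0 \<le> c" "c < 1" and P: "\<And>x y. norm (P x - P y) \<le> c * norm (x - y)"
  shows "bij (\<lambda>x. x - P x)"
proof (rule bijI)
  show "inj (\<lambda>x. x - P x)"
  proof (rule injI)
    fix x y
    assume "x - P x = y - P y"
    then have "P x - P y = x - y"
      by (simp add: algebra_simps)
    then have "(1 - c) * norm (x - y) \<le> 0"
      using P[of x y] by (simp add: left_diff_distrib)
    then show "x = y"
      using c by (simp add: mult_le_0_iff)
  qed
  have "\<exists>x. x - P x = y" for y
  proof -
    have "\<exists>!x. y + P x = x"
      by (rule banach_fix_type[OF c]) (simp add: dist_norm P)
    then show ?thesis
      by (metis add_diff_cancel_right')
  qed
  then show "surj (\<lambda>x. x - P x)"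
    by (metis surjI)
qed

text \<open>Exhibits the inverse of \<open>x \<mapsto> x - P x\<close> as a limit of functions built from \<open>P\<close> by composition,
  which shows that it depends measurably on everything that \<open>P\<close> depends on measurably.\<close>

lemma fixed_point_iterates_tendsto:
  fixes P :: "'a::real_normed_vector \<Rightarrow> 'a"
  assumes c: "0 \<le> c" "c < 1" and P: "\<And>x y. norm (P x - P y) \<le> c * norm (x - y)"
    and z: "z - P z = x"
  shows "(\<lambda>n. ((\<lambda>y. x + P y) ^^ n) x) \<longlonglongrightarrow> z"
proof (rule Lim_null_comparison[THEN LIM_zero_cancel])
  have "norm (((\<lambda>y. x + P y) ^^ n) x - z) \<le> c ^ n * norm (x - z)" for n
  proof (induction n)
    case (Suc n)
    let ?y = "((\<lambda>y. x + P y) ^^ n) x"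
    have "((\<lambda>y. x + P y) ^^ Suc n) x - z = P ?y - P z"
      by (simp flip: z)
    then have "norm (((\<lambda>y. x + P y) ^^ Suc n) x - z) \<le> c * norm (?y - z)"
      using P[of ?y z] by (simp only:)
    also have "\<dots> \<le> c * (c ^ n * norm (x - z))"
      using Suc c by (intro mult_left_mono)
    finally show ?case by simp
  qed simp
  then show "\<forall>\<^sub>F n in sequentially. norm (((\<lambda>y. x + P y) ^^ n) x - z) \<le> c ^ n * norm (x - z)"
    by simp
  show "(\<lambda>n. c ^ n * norm (x - z)) \<longlonglongrightarrow> 0"
    using c by (intro tendsto_mult_left_zero LIMSEQ_power_zero) simp
qed

lemma has_derivative_grad_step:
  fixes g :: "real^'d::finite \<Rightarrow> real"
  assumes "Ck 2 g"
  shows "(grad_step \<eta> g has_derivative (\<lambda>v. v v* (mat 1 - \<eta> *\<^sub>R hessian g x))) (at x)"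
proof -
  have "v v* (mat 1 - \<eta> *\<^sub>R hessian g x) = v - \<eta> *\<^sub>R (v v* hessian g x)" for v
    by (simp add: vector_matrix_mult_diff_rdistrib vector_scaleR_matrix_ac)
  then show ?thesis
    unfolding grad_step_def
    by (auto intro!: derivative_eq_intros has_derivative_grad assms)
qed

lemma det_grad_step_derivative:
  fixes g :: "real^'d::finite \<Rightarrow> real"
  shows "det (matrix (\<lambda>v. v v* (mat 1 - \<eta> *\<^sub>R hessian g x))) = step_det \<eta> g x"
proof -
  have "matrix (\<lambda>v. v v* A) = transpose A" for A :: "real^'d^'d"
    by (simp flip: transpose_matrix_vector)
  then show ?thesis
    by (simp add: step_det_def)
qed

text \<open>A vector \<open>v\<close> killed by the derivative satisfies \<open>norm v = \<eta> * norm (v v* H) \<le> \<eta> L * norm v\<close> with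
  \<open>\<eta> L < 1\<close>, hence vanishes.\<close>

lemma step_det_nonzero:
  fixes g :: "real^'d::finite \<Rightarrow> real"
  assumes M: "\<And>i j. \<bar>partial i (partial j g) x\<bar> \<le> M"
    and \<eta>: "0 \<le> \<eta>" "\<eta> * ((real CARD('d))\<^sup>2 * M) < 1"
  shows "step_det \<eta> g x \<noteq> 0"
proof -
  let ?A = "\<lambda>v. v v* (mat 1 - \<eta> *\<^sub>R hessian g x)"
  have A: "?A v = v - \<eta> *\<^sub>R (v v* hessian g x)" for v
    by (simp add: vector_matrix_mult_diff_rdistrib vector_scaleR_matrix_ac)
  have lin: "linear ?A"
    by (rule linearI) (simp_all add: vector_matrix_left_distrib scaleR_vector_matrix_assoc)
  have "v = 0" if "?A v = 0" for v
  proof -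
    have "norm v = \<eta> * norm (v v* hessian g x)"
      using that \<eta> by (simp add: A) (metis abs_of_nonneg norm_scaleR)
    also have "\<dots> \<le> \<eta> * ((real CARD('d))\<^sup>2 * M * norm v)"
      using \<eta> by (intro mult_left_mono norm_vector_matrix_mult_le) (simp_all add: hessian_def M)
    finally have "(1 - \<eta> * ((real CARD('d))\<^sup>2 * M)) * norm v \<le> 0"
      by (simp add: algebra_simps)
    then show ?thesis
      using \<eta> by (simp add: mult_le_0_iff)
  qed
  then have "inj ?A"
    using linear_injective_0[OF lin] by blast
  then show ?thesis
    using det_nz_iff_inj[OF lin] by (simp add: det_grad_step_derivative)
qed

lemma bij_grad_step:
  fixes g :: "real^'d::finite \<Rightarrow> real"
  assumes g: "Ck 2 g" and M: "\<And>x i j. \<bar>partial i (partial j g) x\<bar> \<le> M"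
    and \<eta>: "0 \<le> \<eta>" "\<eta> * ((real CARD('d))\<^sup>2 * M) < 1"
  shows "bij (grad_step \<eta> g)"
proof -
  have "norm (\<eta> *\<^sub>R grad g x - \<eta> *\<^sub>R grad g y) \<le> \<eta> * ((real CARD('d))\<^sup>2 * M) * norm (x - y)" for x y
    using mult_left_mono[OF grad_lipschitz[OF g M, of x y] \<eta>(1)] \<eta>(1)
    by (simp add: mult.assoc flip: scaleR_diff_right)
  moreover have "0 \<le> \<eta> * ((real CARD('d))\<^sup>2 * M)"
    using \<eta> order_trans[OF abs_ge_zero M] by simp
  ultimately show ?thesis
    unfolding grad_step_def using \<eta> by (intro bij_minus_contraction[of "\<eta> * ((real CARD('d))\<^sup>2 * M)"]) auto
qed

lemma grad_step_iterates_tendsto: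
  fixes g :: "real^'d::finite \<Rightarrow> real"
  assumes g: "Ck 2 g" and M: "\<And>x i j. \<bar>partial i (partial j g) x\<bar> \<le> M"
    and \<eta>: "0 \<le> \<eta>" "\<eta> * ((real CARD('d))\<^sup>2 * M) < 1"
  shows "(\<lambda>n. ((\<lambda>y. x + \<eta> *\<^sub>R grad g y) ^^ n) x) \<longlonglongrightarrow> inv (grad_step \<eta> g) x"
proof (rule fixed_point_iterates_tendsto)
  show "norm (\<eta> *\<^sub>R grad g x - \<eta> *\<^sub>R grad g y) \<le> \<eta> * ((real CARD('d))\<^sup>2 * M) * norm (x - y)" for x y
    using mult_left_mono[OF grad_lipschitz[OF g M, of x y] \<eta>(1)] \<eta>(1)
    by (simp add: mult.assoc flip: scaleR_diff_right)
  show "0 \<le> \<eta> * ((real CARD('d))\<^sup>2 * M)"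
    using \<eta> order_trans[OF abs_ge_zero M] by simp
  show "inv (grad_step \<eta> g) x - \<eta> *\<^sub>R grad g (inv (grad_step \<eta> g) x) = x"
    using surj_f_inv_f[OF bij_is_surj[OF bij_grad_step[OF assms]], of x]
    by (simp add: grad_step_def)
qed (rule \<eta>(2))

section \<open>Measurable dependence of the gradient step on the parameter\<close>

lemma borel_measurable_vec_componentwise:
  fixes F :: "'a \<Rightarrow> real^'d"
  assumes "\<And>i. (\<lambda>x. F x $ i) \<in> borel_measurable M"
  shows "F \<in> borel_measurable M"
  using assms by (auto simp: borel_measurable_euclidean_space[of F] Basis_vec_def inner_axis)

text \<open>A partial derivative is a limit of difference quotients along a sequence, and these are measurable
  in the parameter.\<close>

lemma borel_measurable_partial_parameter:
  fixes f :: "'k \<Rightarrow> real^'d::finite \<Rightarrow> real"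
  assumes meas: "\<And>x. (\<lambda>\<xi>. f \<xi> x) \<in> borel_measurable M"
    and diff: "\<And>\<xi> x. \<xi> \<in> space M \<Longrightarrow> f \<xi> differentiable (at x)"
  shows "(\<lambda>\<xi>. partial i (f \<xi>) x) \<in> borel_measurable M"
proof (rule borel_measurable_LIMSEQ_real)
  let ?h = "\<lambda>n. inverse (real (Suc n))"
  let ?q = "\<lambda>n \<xi>. (f \<xi> (x + ?h n *\<^sub>R axis i 1) - f \<xi> x) / ?h n"
  show "?q n \<in> borel_measurable M" for n
    using meas by (intro borel_measurable_divide borel_measurable_diff borel_measurable_const)
  fix \<xi>
  assume "\<xi> \<in> space M"
  then have "((\<lambda>t. f \<xi> (x + t *\<^sub>R axis i 1)) has_real_derivative partial i (f \<xi>) x) (at 0)"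
    using DERIV_partial[OF diff, of \<xi> x i 0] by simp
  then have "((\<lambda>h. (f \<xi> (x + h *\<^sub>R axis i 1) - f \<xi> x) / h) \<longlongrightarrow> partial i (f \<xi>) x) (at 0)"
    by (simp add: DERIV_def)
  moreover have "filterlim ?h (at 0) sequentially"
    by (simp add: filterlim_at LIMSEQ_inverse_real_of_nat del: of_nat_Suc)
  ultimately show "(\<lambda>n. ?q n \<xi>) \<longlonglongrightarrow> partial i (f \<xi>) x"
    by (rule filterlim_compose)
qed

context
  fixes M :: "'k measure" and f :: "'k \<Rightarrow> real^'d::finite \<Rightarrow> real"
  assumes meas: "\<And>x. (\<lambda>\<xi>. f \<xi> x) \<in> borel_measurable M"
    and f: "\<And>\<xi>. \<xi> \<in> space M \<Longrightarrow> Ck 2 (f \<xi>)"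
begin

lemma borel_measurable_grad: "(\<lambda>(\<xi>, x). grad (f \<xi>) x) \<in> borel_measurable (M \<Otimes>\<^sub>M borel)"
proof (rule borel_measurable_caratheodory)
  show "(\<lambda>\<xi>. grad (f \<xi>) x) \<in> borel_measurable M" for x
  proof (rule borel_measurable_vec_componentwise)
    show "(\<lambda>\<xi>. grad (f \<xi>) x $ i) \<in> borel_measurable M" for i
      unfolding grad_def vec_lambda_beta
      by (rule borel_measurable_partial_parameter[OF meas Ck_2D(1)[OF f]])
  qed
  show "continuous_on UNIV (grad (f \<xi>))" if "\<xi> \<in> space M" for \<xi>
  proof (rule continuous_at_imp_continuous_on, rule ballI)
    show "isCont (grad (f \<xi>)) x" for x
      by (rule has_derivative_continuous[OF has_derivative_grad[OF f[OF that]]])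
  qed
qed

lemma borel_measurable_grad_step:
  "(\<lambda>(\<xi>, x). grad_step \<eta> (f \<xi>) x) \<in> borel_measurable (M \<Otimes>\<^sub>M borel)"
proof -
  note borel_measurable_grad[measurable]
  show ?thesis
    unfolding grad_step_def by measurable
qed

lemma borel_measurable_step_det:
  "(\<lambda>(\<xi>, x). step_det \<eta> (f \<xi>) x) \<in> borel_measurable (M \<Otimes>\<^sub>M borel)"
proof -
  have [measurable]: "(\<lambda>(\<xi>, x). hessian (f \<xi>) x $ i $ j) \<in> borel_measurable (M \<Otimes>\<^sub>M borel)" for i j
  proof (rule borel_measurable_caratheodory)
    show "(\<lambda>\<xi>. hessian (f \<xi>) x $ i $ j) \<in> borel_measurable M" for x
      unfolding hessian_def vec_lambda_beta
      by (intro borel_measurable_partial_parameter meas Ck_2D(1,2)[OF f])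
    show "continuous_on UNIV (\<lambda>x. hessian (f \<xi>) x $ i $ j)" if "\<xi> \<in> space M" for \<xi>
      unfolding hessian_def vec_lambda_beta by (rule Ck_2D(3)[OF f[OF that]])
  qed
  show ?thesis
    unfolding step_det_def det_def by simp
qed

lemma borel_measurable_inv_grad_step:
  assumes M: "\<And>\<xi> x i j. \<xi> \<in> space M \<Longrightarrow> \<bar>partial i (partial j (f \<xi>)) x\<bar> \<le> B"
    and \<eta>: "0 \<le> \<eta>" "\<eta> * ((real CARD('d))\<^sup>2 * B) < 1"
  shows "(\<lambda>(\<xi>, x). inv (grad_step \<eta> (f \<xi>)) x) \<in> borel_measurable (M \<Otimes>\<^sub>M borel)"
proof (rule borel_measurable_LIMSEQ_metric)
  note borel_measurable_grad[measurable]
  show "(\<lambda>(\<xi>, x). ((\<lambda>y. x + \<eta> *\<^sub>R grad (f \<xi>) y) ^^ n) x) \<in> borel_measurable (M \<Otimes>\<^sub>M borel)" for n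
  proof (induction n)
    case (Suc n)
    note Suc[measurable]
    show ?case by simp
  qed simp
  fix p :: "'k \<times> (real^'d)"
  assume "p \<in> space (M \<Otimes>\<^sub>M borel)"
  then show "(\<lambda>n. case p of (\<xi>, x) \<Rightarrow> ((\<lambda>y. x + \<eta> *\<^sub>R grad (f \<xi>) y) ^^ n) x) \<longlonglongrightarrow>
      (case p of (\<xi>, x) \<Rightarrow> inv (grad_step \<eta> (f \<xi>)) x)"
    using grad_step_iterates_tendsto[OF f M \<eta>] by (auto simp: space_pair_measure)
qed

end

section \<open>Transfer operators of random diffeomorphisms\<close>

text \<open>Reduces statements about equivalence classes of functions to fixed \<open>\<xi>\<close>: a property that fails on
  a null set pulls back, for each \<open>\<xi>\<close>, to one that fails on a null set, and Fubini exchanges the two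
  quantifiers "almost every". Replacing the exceptional set by a Borel null set makes the exchange
  legitimate for properties \<open>Q\<close> that are not measurable themselves.\<close>

lemma AE_swap_preserving_null:
  fixes g :: "'k \<Rightarrow> 'a::euclidean_space \<Rightarrow> 'a"
  assumes \<nu>: "prob_space \<nu>"
    and g[measurable]: "(\<lambda>(\<xi>, x). g \<xi> x) \<in> borel_measurable (\<nu> \<Otimes>\<^sub>M borel)"
    and pres: "\<And>\<xi> N. \<xi> \<in> space \<nu> \<Longrightarrow> N \<in> null_sets lborel \<Longrightarrow> AE x in lborel. g \<xi> x \<notin> N"
    and Q: "AE x in lborel. Q x"
  shows "AE x in lborel. AE \<xi> in \<nu>. Q (g \<xi> x)"
proof -
  interpret \<nu>: prob_space \<nu> by fact
  interpret pair_sigma_finite \<nu> "lborel :: 'a measure" ..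
  from AE_E[OF Q] obtain N where sub: "{x \<in> space lborel. \<not> Q x} \<subseteq> N"
    and N: "emeasure lborel N = 0" "N \<in> sets lborel"
    by blast
  then have null: "N \<in> null_sets lborel"
    by (simp add: null_sets_def)
  have [measurable]: "N \<in> sets borel"
    using N by simp
  have "AE \<xi> in \<nu>. AE x in lborel. g \<xi> x \<notin> N"
    by (rule AE_I2) (rule pres[OF _ null])
  moreover have "{p \<in> space (\<nu> \<Otimes>\<^sub>M lborel). g (fst p) (snd p) \<notin> N} \<in> sets (\<nu> \<Otimes>\<^sub>M lborel)"
    by measurable
  ultimately have "AE x in lborel. AE \<xi> in \<nu>. g \<xi> x \<notin> N"
    by (simp add: AE_commute)
  moreover have "Q x" if "x \<notin> N" for x
    using that sub by auto
  ultimately show ?thesis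
    by (auto elim!: eventually_mono)
qed

lemma integrable_pair_uniform_bound:
  fixes F :: "'k \<Rightarrow> 'a::euclidean_space \<Rightarrow> real"
  assumes \<nu>: "prob_space \<nu>"
    and [measurable]: "(\<lambda>(\<xi>, x). F \<xi> x) \<in> borel_measurable (\<nu> \<Otimes>\<^sub>M lborel)"
    and int: "\<And>\<xi>. \<xi> \<in> space \<nu> \<Longrightarrow> integrable lborel (F \<xi>)"
    and bound: "\<And>\<xi>. \<xi> \<in> space \<nu> \<Longrightarrow> (\<integral>x. \<bar>F \<xi> x\<bar> \<partial>lborel) \<le> K"
  shows "integrable (\<nu> \<Otimes>\<^sub>M lborel) (\<lambda>(\<xi>, x). F \<xi> x)"
proof -
  interpret prob_space \<nu> by fact
  interpret pair_sigma_finite \<nu> "lborel :: 'a measure" ..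
  show ?thesis
  proof (rule Fubini_integrable)
    show "integrable \<nu> (\<lambda>\<xi>. \<integral>x. norm (case (\<xi>, x) of (\<xi>, x) \<Rightarrow> F \<xi> x) \<partial>lborel)"
    proof (rule integrable_const_bound)
      show "AE \<xi> in \<nu>. norm (\<integral>x. norm (case (\<xi>, x) of (\<xi>, x) \<Rightarrow> F \<xi> x) \<partial>lborel) \<le> K"
        using bound by (intro AE_I2) (simp add: integral_nonneg)
    qed measurable
    show "AE \<xi> in \<nu>. integrable lborel (\<lambda>x. case (\<xi>, x) of (\<xi>, x) \<Rightarrow> F \<xi> x)"
      using int by (intro AE_I2) simp
  qed measurable
qed

lemma LinfD:
  assumes "u \<in> Linf"
  obtains C where "u \<in> borel_measurable borel" "0 \<le> C" "AE x in lborel. \<bar>u x\<bar> \<le> C"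
proof -
  obtain C where C: "AE x in lborel. \<bar>u x\<bar> \<le> C" and u: "u \<in> borel_measurable borel"
    using assms by (auto simp: Linf_def)
  have "AE x in lborel. \<bar>u x\<bar> \<le> max 0 C"
    using C by (auto elim!: eventually_mono)
  then show thesis
    using that[OF u, of "max 0 C"] by simp
qed

lemma one_in_Linf: "(\<lambda>_. 1) \<in> Linf"
  by (auto simp: Linf_def)

text \<open>Abstracts a random diffeomorphism \<open>\<Phi>\<close> with inverse \<open>h\<close>, where \<open>w\<close> stands for the absolute Jacobian
  determinant of \<open>h\<close>. The last assumption is the change of variables formula; it expresses that \<open>h \<xi>\<close> transports \<open>w \<xi> dx\<close> to Lebesgue measure.\<close>

locale random_diffeomorphism = prob_space \<nu> for \<nu> :: "'k measure" +
  fixes \<Phi> h :: "'k \<Rightarrow> real^'d::finite \<Rightarrow> real^'d" and w :: "'k \<Rightarrow> real^'d \<Rightarrow> real"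
  assumes \<Phi>_meas[measurable]: "(\<lambda>(\<xi>, x). \<Phi> \<xi> x) \<in> borel_measurable (\<nu> \<Otimes>\<^sub>M borel)"
    and h_meas[measurable]: "(\<lambda>(\<xi>, x). h \<xi> x) \<in> borel_measurable (\<nu> \<Otimes>\<^sub>M borel)"
    and w_meas[measurable]: "(\<lambda>(\<xi>, x). w \<xi> x) \<in> borel_measurable (\<nu> \<Otimes>\<^sub>M borel)"
    and w_pos: "\<And>\<xi> x. \<xi> \<in> space \<nu> \<Longrightarrow> 0 < w \<xi> x"
    and \<Phi>_h: "\<And>\<xi> x. \<xi> \<in> space \<nu> \<Longrightarrow> \<Phi> \<xi> (h \<xi> x) = x"
    and nn_integral_h: "\<And>\<xi> p. \<xi> \<in> space \<nu> \<Longrightarrow> p \<in> borel_measurable borel \<Longrightarrow>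
      (\<integral>\<^sup>+x. p (h \<xi> x) * ennreal (w \<xi> x) \<partial>lborel) = (\<integral>\<^sup>+z. p z \<partial>lborel)"
begin

sublocale pair_sigma_finite \<nu> "lborel :: (real^'d) measure" ..

lemma section_measurable:
  assumes "\<xi> \<in> space \<nu>"
  shows "\<Phi> \<xi> \<in> borel_measurable borel" "h \<xi> \<in> borel_measurable borel" "w \<xi> \<in> borel_measurable borel"
  using measurable_compose[OF measurable_Pair1'[OF assms] \<Phi>_meas]
    measurable_compose[OF measurable_Pair1'[OF assms] h_meas]
    measurable_compose[OF measurable_Pair1'[OF assms] w_meas]
  by simp_all

text \<open>If \<open>N\<close> is null, the change of variables formula gives \<open>h \<xi> -` N\<close> the weighted measure zero, and
  the weight is positive.\<close>

lemma h_preserves_null: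
  assumes \<xi>: "\<xi> \<in> space \<nu>" and N: "N \<in> null_sets lborel"
  shows "AE x in lborel. h \<xi> x \<notin> N"
proof -
  note section_measurable[OF \<xi>, measurable]
  have [measurable]: "N \<in> sets borel" and N0: "emeasure lborel N = 0"
    using N by (auto simp: null_sets_def)
  have "(\<integral>\<^sup>+x. indicator N (h \<xi> x) * ennreal (w \<xi> x) \<partial>lborel) = 0"
    using N0 by (subst nn_integral_h[OF \<xi>]) auto
  then have "AE x in lborel. indicator N (h \<xi> x) * ennreal (w \<xi> x) = 0"
    by (subst (asm) nn_integral_0_iff_AE) auto
  then show ?thesis
  proof eventually_elim
    case (elim x)
    have "ennreal (w \<xi> x) \<noteq> 0"
      using w_pos[OF \<xi>, of x] by (simp add: ennreal_eq_0_iff)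
    with elim show ?case
      by (auto simp: indicator_def split: if_splits)
  qed
qed

text \<open>Here the change of variables formula expresses the measure of \<open>\<Phi> \<xi> -` N\<close> as the integral of \<open>w \<xi>\<close>
  over \<open>N\<close>.\<close>

lemma \<Phi>_preserves_null:
  assumes \<xi>: "\<xi> \<in> space \<nu>" and N: "N \<in> null_sets lborel"
  shows "AE x in lborel. \<Phi> \<xi> x \<notin> N"
proof -
  note section_measurable[OF \<xi>, measurable]
  have [measurable]: "N \<in> sets borel"
    using N by (auto simp: null_sets_def)
  have "(\<integral>\<^sup>+z. indicator N (\<Phi> \<xi> z) \<partial>lborel) = (\<integral>\<^sup>+x. indicator N (\<Phi> \<xi> (h \<xi> x)) * ennreal (w \<xi> x) \<partial>lborel)"
    by (rule nn_integral_h[OF \<xi>, symmetric]) simp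
  also have "\<dots> = 0"
    using AE_not_in[OF N] by (subst nn_integral_0_iff_AE) (auto simp: \<Phi>_h[OF \<xi>] elim!: eventually_mono)
  finally have "AE z in lborel. indicator N (\<Phi> \<xi> z) = (0 :: ennreal)"
    by (subst (asm) nn_integral_0_iff_AE) auto
  then show ?thesis
    by (auto elim!: eventually_mono simp: indicator_def split: if_splits)
qed

lemma AE_\<Phi>: "AE x in lborel. Q x \<Longrightarrow> AE x in lborel. AE \<xi> in \<nu>. Q (\<Phi> \<xi> x)"
  by (rule AE_swap_preserving_null[OF prob_space_axioms \<Phi>_meas \<Phi>_preserves_null])

lemma AE_h: "AE x in lborel. Q x \<Longrightarrow> AE x in lborel. AE \<xi> in \<nu>. Q (h \<xi> x)"
  by (rule AE_swap_preserving_null[OF prob_space_axioms h_meas h_preserves_null])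

lemma distr_h:
  assumes \<xi>: "\<xi> \<in> space \<nu>"
  shows "distr (density lborel (\<lambda>x. ennreal (w \<xi> x))) borel (h \<xi>) = lborel"
proof (rule measure_eqI)
  note section_measurable[OF \<xi>, measurable]
  fix A
  assume "A \<in> sets (distr (density lborel (\<lambda>x. ennreal (w \<xi> x))) borel (h \<xi>))"
  then have [measurable]: "A \<in> sets borel" by simp
  have "emeasure (distr (density lborel (\<lambda>x. ennreal (w \<xi> x))) borel (h \<xi>)) A =
      (\<integral>\<^sup>+y. indicator A y \<partial>distr (density lborel (\<lambda>x. ennreal (w \<xi> x))) borel (h \<xi>))"
    by simp
  also have "\<dots> = (\<integral>\<^sup>+x. indicator A (h \<xi> x) * ennreal (w \<xi> x) \<partial>lborel)"
    by (subst nn_integral_distr, measurable) (subst nn_integral_density, auto simp: mult.commute)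
  finally have "emeasure (distr (density lborel (\<lambda>x. ennreal (w \<xi> x))) borel (h \<xi>)) A =
      (\<integral>\<^sup>+x. indicator A (h \<xi> x) * ennreal (w \<xi> x) \<partial>lborel)" .
  then show "emeasure (distr (density lborel (\<lambda>x. ennreal (w \<xi> x))) borel (h \<xi>)) A = emeasure lborel A"
    by (simp add: nn_integral_h[OF \<xi>])
qed simp

lemma
  fixes p :: "real^'d \<Rightarrow> real"
  assumes \<xi>: "\<xi> \<in> space \<nu>" and p[measurable]: "p \<in> borel_measurable borel"
  shows integrable_h_iff: "integrable lborel (\<lambda>x. p (h \<xi> x) * w \<xi> x) \<longleftrightarrow> integrable lborel p"
    and integral_h: "(\<integral>x. p (h \<xi> x) * w \<xi> x \<partial>lborel) = (\<integral>z. p z \<partial>lborel)"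
proof -
  note section_measurable[OF \<xi>, measurable]
  have w: "AE x in lborel. 0 \<le> w \<xi> x"
    using w_pos[OF \<xi>] by (auto intro: less_imp_le)
  have "integrable lborel p \<longleftrightarrow> integrable (distr (density lborel (\<lambda>x. ennreal (w \<xi> x))) borel (h \<xi>)) p"
    by (simp add: distr_h[OF \<xi>])
  also have "\<dots> \<longleftrightarrow> integrable lborel (\<lambda>x. p (h \<xi> x) * w \<xi> x)"
    by (simp add: integrable_distr_eq integrable_real_density w mult.commute)
  finally show "integrable lborel (\<lambda>x. p (h \<xi> x) * w \<xi> x) \<longleftrightarrow> integrable lborel p" ..
  have "(\<integral>z. p z \<partial>lborel) = (\<integral>z. p z \<partial>distr (density lborel (\<lambda>x. ennreal (w \<xi> x))) borel (h \<xi>))"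
    by (simp add: distr_h[OF \<xi>])
  also have "\<dots> = (\<integral>x. p (h \<xi> x) * w \<xi> x \<partial>lborel)"
    by (simp add: integral_distr integral_real_density w mult.commute)
  finally show "(\<integral>x. p (h \<xi> x) * w \<xi> x \<partial>lborel) = (\<integral>z. p z \<partial>lborel)" ..
qed

definition S :: "(real^'d \<Rightarrow> real) \<Rightarrow> real^'d \<Rightarrow> real" where
  "S u x = (\<integral>\<xi>. u (\<Phi> \<xi> x) \<partial>\<nu>)"

definition S_dual :: "(real^'d \<Rightarrow> real) \<Rightarrow> real^'d \<Rightarrow> real" where
  "S_dual \<rho> x = (\<integral>\<xi>. \<rho> (h \<xi> x) * w \<xi> x \<partial>\<nu>)"

lemma S_borel_measurable:
  assumes [measurable]: "u \<in> borel_measurable borel"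
  shows "S u \<in> borel_measurable lborel"
  unfolding S_def by measurable

lemma section_measurable_\<nu>:
  shows "(\<lambda>\<xi>. \<Phi> \<xi> x) \<in> borel_measurable \<nu>" "(\<lambda>\<xi>. h \<xi> x) \<in> borel_measurable \<nu>"
    "(\<lambda>\<xi>. w \<xi> x) \<in> borel_measurable \<nu>"
  by measurable

lemma AE_integrable_S:
  assumes "u \<in> Linf"
  shows "AE x in lborel. integrable \<nu> (\<lambda>\<xi>. u (\<Phi> \<xi> x))"
proof -
  obtain C where [measurable]: "u \<in> borel_measurable borel" and C: "AE x in lborel. \<bar>u x\<bar> \<le> C"
    using LinfD[OF assms] .
  have [measurable]: "(\<lambda>\<xi>. \<Phi> \<xi> x) \<in> borel_measurable \<nu>" for x
    by (rule section_measurable_\<nu>)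
  show ?thesis
    using AE_\<Phi>[OF C] by eventually_elim (rule integrable_const_bound[of _ C], auto)
qed

lemma S_maps_classes: "maps_classes S Linf Linf"
  unfolding maps_classes_def
proof (intro conjI ballI impI)
  have [measurable]: "(\<lambda>\<xi>. \<Phi> \<xi> x) \<in> borel_measurable \<nu>" for x
    by (rule section_measurable_\<nu>)
  fix u :: "real^'d \<Rightarrow> real"
  assume u: "u \<in> Linf"
  obtain C where um[measurable]: "u \<in> borel_measurable borel" and C: "AE x in lborel. \<bar>u x\<bar> \<le> C"
    using LinfD[OF u] .
  have "AE x in lborel. \<bar>S u x\<bar> \<le> C"
    using AE_\<Phi>[OF C]
  proof eventually_elim
    case (elim x)
    have "\<bar>S u x\<bar> \<le> (\<integral>\<xi>. \<bar>u (\<Phi> \<xi> x)\<bar> \<partial>\<nu>)"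
      unfolding S_def by (rule integral_abs_bound)
    also have "\<dots> \<le> C"
      using elim by (intro integral_le_const integrable_const_bound[of _ C]) auto
    finally show ?case .
  qed
  then show "S u \<in> Linf"
    using S_borel_measurable[OF um] by (auto simp: Linf_def)
next
  have [measurable]: "(\<lambda>\<xi>. \<Phi> \<xi> x) \<in> borel_measurable \<nu>" for x
    by (rule section_measurable_\<nu>)
  fix u v :: "real^'d \<Rightarrow> real"
  assume "u \<in> Linf" "v \<in> Linf" and eq: "AE x in lborel. u x = v x"
  then have [measurable]: "u \<in> borel_measurable borel" "v \<in> borel_measurable borel"
    by (auto simp: Linf_def)
  show "AE x in lborel. S u x = S v x"
    using AE_\<Phi>[OF eq] unfolding S_def by eventually_elim (rule integral_cong_AE, auto)
qed

text \<open>The duality for a single value of \<open>\<xi>\<close>, obtained by substituting \<open>z = h \<xi> x\<close>.\<close>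

lemma dual_pairing_section:
  assumes \<xi>: "\<xi> \<in> space \<nu>" and u[measurable]: "u \<in> borel_measurable borel"
    and [measurable]: "\<rho> \<in> borel_measurable borel"
  shows "(\<integral>x. u x * (\<rho> (h \<xi> x) * w \<xi> x) \<partial>lborel) = (\<integral>z. u (\<Phi> \<xi> z) * \<rho> z \<partial>lborel)"
    and "integrable lborel (\<lambda>x. u x * (\<rho> (h \<xi> x) * w \<xi> x)) \<longleftrightarrow> integrable lborel (\<lambda>z. u (\<Phi> \<xi> z) * \<rho> z)"
proof -
  note section_measurable[OF \<xi>, measurable]
  have m: "(\<lambda>z. u (\<Phi> \<xi> z) * \<rho> z) \<in> borel_measurable borel"
    by measurable
  show "(\<integral>x. u x * (\<rho> (h \<xi> x) * w \<xi> x) \<partial>lborel) = (\<integral>z. u (\<Phi> \<xi> z) * \<rho> z \<partial>lborel)"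
    using integral_h[OF \<xi> m] by (simp add: \<Phi>_h[OF \<xi>] mult.assoc)
  show "integrable lborel (\<lambda>x. u x * (\<rho> (h \<xi> x) * w \<xi> x)) \<longleftrightarrow> integrable lborel (\<lambda>z. u (\<Phi> \<xi> z) * \<rho> z)"
    using integrable_h_iff[OF \<xi> m] by (simp add: \<Phi>_h[OF \<xi>] mult.assoc)
qed

text \<open>For every \<open>\<xi>\<close> both integrands have the same \<open>L\<^sup>1\<close> norm, which is at most the essential bound of
  \<open>u\<close> times the norm of \<open>\<rho>\<close>.\<close>

lemma
  assumes u: "u \<in> Linf" and \<rho>: "\<rho> \<in> L1"
  shows integrable_pair_S: "integrable (\<nu> \<Otimes>\<^sub>M lborel) (\<lambda>(\<xi>, x). u (\<Phi> \<xi> x) * \<rho> x)"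
    and integrable_pair_S_dual: "integrable (\<nu> \<Otimes>\<^sub>M lborel) (\<lambda>(\<xi>, x). u x * (\<rho> (h \<xi> x) * w \<xi> x))"
proof -
  obtain C where um[measurable]: "u \<in> borel_measurable borel" and C: "AE x in lborel. \<bar>u x\<bar> \<le> C" "0 \<le> C"
    using LinfD[OF u] .
  have int: "integrable lborel \<rho>" and [measurable]: "\<rho> \<in> borel_measurable borel"
    using \<rho> by (auto simp: L1_def dest: borel_measurable_integrable)
  have S: "integrable lborel (\<lambda>x. u (\<Phi> \<xi> x) * \<rho> x)"
    "(\<integral>x. \<bar>u (\<Phi> \<xi> x) * \<rho> x\<bar> \<partial>lborel) \<le> C * (\<integral>x. \<bar>\<rho> x\<bar> \<partial>lborel)" if \<xi>: "\<xi> \<in> space \<nu>" for \<xi>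
  proof -
    note section_measurable[OF \<xi>, measurable]
    obtain N where sub: "{x \<in> space lborel. \<not> \<bar>u x\<bar> \<le> C} \<subseteq> N" and N: "N \<in> null_sets lborel"
      using AE_E[OF C(1)] by (metis null_setsI)
    have AE_u: "AE x in lborel. \<bar>u (\<Phi> \<xi> x)\<bar> \<le> C"
      using \<Phi>_preserves_null[OF \<xi> N] by eventually_elim (use sub in auto)
    then have AE: "AE x in lborel. \<bar>u (\<Phi> \<xi> x) * \<rho> x\<bar> \<le> C * \<bar>\<rho> x\<bar>"
      by eventually_elim (simp add: abs_mult mult_right_mono)
    show 1: "integrable lborel (\<lambda>x. u (\<Phi> \<xi> x) * \<rho> x)"
      using C(2) AE by (intro Bochner_Integration.integrable_bound[OF integrable_mult_right[OF int, of C]])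
        (auto simp: abs_mult)
    have "(\<integral>x. \<bar>u (\<Phi> \<xi> x) * \<rho> x\<bar> \<partial>lborel) \<le> (\<integral>x. C * \<bar>\<rho> x\<bar> \<partial>lborel)"
      using 1 int AE by (intro integral_mono_AE) auto
    then show "(\<integral>x. \<bar>u (\<Phi> \<xi> x) * \<rho> x\<bar> \<partial>lborel) \<le> C * (\<integral>x. \<bar>\<rho> x\<bar> \<partial>lborel)"
      by simp
  qed
  show "integrable (\<nu> \<Otimes>\<^sub>M lborel) (\<lambda>(\<xi>, x). u (\<Phi> \<xi> x) * \<rho> x)"
    using S by (intro integrable_pair_uniform_bound[OF prob_space_axioms]) measurable
  show "integrable (\<nu> \<Otimes>\<^sub>M lborel) (\<lambda>(\<xi>, x). u x * (\<rho> (h \<xi> x) * w \<xi> x))"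
  proof (rule integrable_pair_uniform_bound[OF prob_space_axioms])
    fix \<xi> assume \<xi>: "\<xi> \<in> space \<nu>"
    show "integrable lborel (\<lambda>x. u x * (\<rho> (h \<xi> x) * w \<xi> x))"
      using S(1)[OF \<xi>] by (subst dual_pairing_section[OF \<xi>]) auto
    have "(\<integral>x. \<bar>u x * (\<rho> (h \<xi> x) * w \<xi> x)\<bar> \<partial>lborel) = (\<integral>x. \<bar>u x\<bar> * (\<bar>\<rho> (h \<xi> x)\<bar> * w \<xi> x) \<partial>lborel)"
      using w_pos[OF \<xi>] by (simp add: abs_mult less_imp_le)
    also have "\<dots> = (\<integral>x. \<bar>u (\<Phi> \<xi> x)\<bar> * \<bar>\<rho> x\<bar> \<partial>lborel)"
      by (rule dual_pairing_section[OF \<xi>]) measurable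
    finally show "(\<integral>x. \<bar>u x * (\<rho> (h \<xi> x) * w \<xi> x)\<bar> \<partial>lborel) \<le> C * (\<integral>x. \<bar>\<rho> x\<bar> \<partial>lborel)"
      using S(2)[OF \<xi>] by (simp add: abs_mult)
  qed measurable
qed

lemma S_is_dual: "is_dual_of S S_dual"
  unfolding is_dual_of_def
proof (intro ballI)
  fix u \<rho> :: "real^'d \<Rightarrow> real"
  assume u: "u \<in> Linf" and \<rho>: "\<rho> \<in> L1"
  have "(\<integral>x. S u x * \<rho> x \<partial>lborel) = (\<integral>x. (\<integral>\<xi>. u (\<Phi> \<xi> x) * \<rho> x \<partial>\<nu>) \<partial>lborel)"
    by (simp add: S_def)
  also have "\<dots> = (\<integral>\<xi>. (\<integral>x. u (\<Phi> \<xi> x) * \<rho> x \<partial>lborel) \<partial>\<nu>)"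
    by (rule Fubini_integral[OF integrable_pair_S[OF u \<rho>]])
  also have "\<dots> = (\<integral>\<xi>. (\<integral>x. u x * (\<rho> (h \<xi> x) * w \<xi> x) \<partial>lborel) \<partial>\<nu>)"
    using u \<rho> by (intro Bochner_Integration.integral_cong refl dual_pairing_section(1)[symmetric])
      (auto simp: Linf_def L1_def dest: borel_measurable_integrable)
  also have "\<dots> = (\<integral>x. (\<integral>\<xi>. u x * (\<rho> (h \<xi> x) * w \<xi> x) \<partial>\<nu>) \<partial>lborel)"
    by (rule Fubini_integral[OF integrable_pair_S_dual[OF u \<rho>], symmetric])
  also have "\<dots> = (\<integral>x. u x * S_dual \<rho> x \<partial>lborel)"
    by (simp add: S_dual_def)
  finally show "(\<integral>x. S u x * \<rho> x \<partial>lborel) = (\<integral>x. u x * S_dual \<rho> x \<partial>lborel)" .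
qed

text \<open>Both claims are Fubini's theorem for the joint integrand of the dual pairing with \<open>u = 1\<close>.\<close>

lemma
  assumes \<rho>: "\<rho> \<in> L1"
  shows AE_integrable_S_dual: "AE x in lborel. integrable \<nu> (\<lambda>\<xi>. \<rho> (h \<xi> x) * w \<xi> x)"
    and S_dual_in_L1: "S_dual \<rho> \<in> L1"
  using AE_integrable_snd[OF integrable_pair_S_dual[OF one_in_Linf \<rho>]]
    integrable_snd[OF integrable_pair_S_dual[OF one_in_Linf \<rho>]]
  by (simp_all add: L1_def S_dual_def[abs_def])

text \<open>Duality against the constant \<open>1\<close>, which \<open>S\<close> fixes because \<open>\<nu>\<close> is a probability measure.\<close>

lemma integral_S_dual:
  assumes \<rho>: "\<rho> \<in> L1"
  shows "(\<integral>x. S_dual \<rho> x \<partial>lborel) = (\<integral>x. \<rho> x \<partial>lborel)"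
proof -
  have "S (\<lambda>_. 1) x = 1" for x
    by (simp add: S_def prob_space)
  then show ?thesis
    using S_is_dual one_in_Linf \<rho> unfolding is_dual_of_def by fastforce
qed

lemma S_dual_maps_classes: "maps_classes S_dual L1 L1"
  unfolding maps_classes_def
proof (intro conjI ballI impI)
  have [measurable]: "(\<lambda>\<xi>. h \<xi> x) \<in> borel_measurable \<nu>" "(\<lambda>\<xi>. w \<xi> x) \<in> borel_measurable \<nu>" for x
    by (rule section_measurable_\<nu>)+
  fix u v :: "real^'d \<Rightarrow> real"
  assume "u \<in> L1" "v \<in> L1" and eq: "AE x in lborel. u x = v x"
  then have [measurable]: "u \<in> borel_measurable borel" "v \<in> borel_measurable borel"
    by (auto simp: L1_def dest: borel_measurable_integrable)
  show "AE x in lborel. S_dual u x = S_dual v x"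
    using AE_h[OF eq] unfolding S_dual_def by eventually_elim (rule integral_cong_AE, auto)
qed (rule S_dual_in_L1)

lemma S_dual_nonneg:
  assumes "AE x in lborel. \<rho> x \<ge> 0"
  shows "AE x in lborel. S_dual \<rho> x \<ge> 0"
  using AE_h[OF assms]
proof eventually_elim
  case (elim x)
  then have "AE \<xi> in \<nu>. 0 \<le> \<rho> (h \<xi> x) * w \<xi> x"
    using AE_space by eventually_elim (simp add: w_pos less_imp_le)
  then show ?case
    unfolding S_dual_def by (rule integral_nonneg_AE)
qed

lemma L1_norm_S_dual_nonneg:
  assumes \<rho>: "\<rho> \<in> L1" and nonneg: "AE x in lborel. \<rho> x \<ge> 0"
  shows "L1_norm (S_dual \<rho>) = L1_norm \<rho>"
proof -
  have abs: "L1_norm g = (\<integral>x. g x \<partial>lborel)" if "AE x in lborel. g x \<ge> 0" "g \<in> L1" for g :: "real^'d \<Rightarrow> real"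
    using that unfolding L1_norm_def L1_def
    by (intro integral_cong_AE) (auto dest: borel_measurable_integrable elim!: eventually_mono)
  show ?thesis
    using abs[OF nonneg \<rho>] abs[OF S_dual_nonneg[OF nonneg] S_dual_in_L1[OF \<rho>]] integral_S_dual[OF \<rho>] by simp
qed

lemma L1_norm_S_dual_le:
  assumes \<rho>: "\<rho> \<in> L1"
  shows "L1_norm (S_dual \<rho>) \<le> L1_norm \<rho>"
proof -
  have abs_\<rho>: "(\<lambda>x. \<bar>\<rho> x\<bar>) \<in> L1"
    using \<rho> by (simp add: L1_def)
  have "\<bar>S_dual \<rho> x\<bar> \<le> S_dual (\<lambda>x. \<bar>\<rho> x\<bar>) x" for x
  proof -
    have "\<bar>S_dual \<rho> x\<bar> \<le> (\<integral>\<xi>. \<bar>\<rho> (h \<xi> x) * w \<xi> x\<bar> \<partial>\<nu>)"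
      unfolding S_dual_def by (rule integral_abs_bound)
    also have "\<dots> = S_dual (\<lambda>x. \<bar>\<rho> x\<bar>) x"
      unfolding S_dual_def using w_pos
      by (intro Bochner_Integration.integral_cong) (auto simp: abs_mult less_imp_le)
    finally show ?thesis .
  qed
  then have "L1_norm (S_dual \<rho>) \<le> (\<integral>x. S_dual (\<lambda>x. \<bar>\<rho> x\<bar>) x \<partial>lborel)"
    using S_dual_in_L1[OF \<rho>] S_dual_in_L1[OF abs_\<rho>] unfolding L1_norm_def L1_def
    by (intro integral_mono) auto
  also have "\<dots> = L1_norm \<rho>"
    by (simp add: integral_S_dual[OF abs_\<rho>] L1_norm_def)
  finally show ?thesis .
qed

end

section \<open>The transfer operator of random gradient descent\<close>

text \<open>The change of variables formula for \<open>\<Phi> \<xi>\<close>, applied to \<open>x \<mapsto> p (h \<xi> x) * w \<xi> x\<close>, is the formula for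
  the inverse: the Jacobian of \<open>\<Phi> \<xi>\<close> cancels against \<open>w \<xi> \<circ> \<Phi> \<xi>\<close>.\<close>

lemma random_diffeomorphism_grad_step:
  fixes \<nu> :: "'k measure" and f :: "'k \<Rightarrow> real^'d::finite \<Rightarrow> real"
  assumes \<nu>: "prob_space \<nu>"
    and meas: "\<And>x. (\<lambda>\<xi>. f \<xi> x) \<in> borel_measurable \<nu>"
    and C2: "\<And>\<xi>. \<xi> \<in> space \<nu> \<Longrightarrow> Ck 2 (f \<xi>)"
    and M: "\<And>\<xi> x i j. \<xi> \<in> space \<nu> \<Longrightarrow> \<bar>partial i (partial j (f \<xi>)) x\<bar> \<le> M"
    and \<eta>: "0 \<le> \<eta>" "\<eta> * ((real CARD('d))\<^sup>2 * M) < 1"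
  shows "random_diffeomorphism \<nu> (\<lambda>\<xi>. grad_step \<eta> (f \<xi>)) (\<lambda>\<xi>. inv (grad_step \<eta> (f \<xi>)))
    (\<lambda>\<xi> x. 1 / \<bar>step_det \<eta> (f \<xi>) (inv (grad_step \<eta> (f \<xi>)) x)\<bar>)"
proof -
  interpret prob_space \<nu> by fact
  let ?h = "\<lambda>\<xi>. inv (grad_step \<eta> (f \<xi>))"
  note [measurable] = borel_measurable_grad_step[OF meas C2]
    borel_measurable_step_det[OF meas C2] borel_measurable_inv_grad_step[OF meas C2 M \<eta>]
  have J: "step_det \<eta> (f \<xi>) x \<noteq> 0" if "\<xi> \<in> space \<nu>" for \<xi> x
    by (rule step_det_nonzero[OF M[OF that] \<eta>])
  have bij: "bij (grad_step \<eta> (f \<xi>))" if "\<xi> \<in> space \<nu>" for \<xi>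
    by (rule bij_grad_step[OF C2[OF that] M[OF that] \<eta>])
  show ?thesis
  proof unfold_locales
    fix \<xi> and p :: "real^'d \<Rightarrow> ennreal"
    assume \<xi>: "\<xi> \<in> space \<nu>" and p[measurable]: "p \<in> borel_measurable borel"
    have [measurable]: "?h \<xi> \<in> borel_measurable borel"
      using measurable_compose[OF measurable_Pair1'[OF \<xi>] borel_measurable_inv_grad_step[OF meas C2 M \<eta>]] by simp
    have [measurable]: "step_det \<eta> (f \<xi>) \<in> borel_measurable borel"
      using measurable_compose[OF measurable_Pair1'[OF \<xi>] borel_measurable_step_det[OF meas C2]] by simp
    have cancel: "ennreal (1 / \<bar>step_det \<eta> (f \<xi>) z\<bar>) * ennreal \<bar>step_det \<eta> (f \<xi>) z\<bar> = 1" for z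
      using J[OF \<xi>, of z] by (simp flip: ennreal_mult)
    have h_step: "?h \<xi> (grad_step \<eta> (f \<xi>) z) = z" for z
      using bij[OF \<xi>] by (simp add: bij_is_inj)
    let ?q = "\<lambda>x. p (?h \<xi> x) * ennreal (1 / \<bar>step_det \<eta> (f \<xi>) (?h \<xi> x)\<bar>)"
    have "(\<integral>\<^sup>+z. ?q (grad_step \<eta> (f \<xi>) z) * ennreal \<bar>step_det \<eta> (f \<xi>) z\<bar> \<partial>lborel) = (\<integral>\<^sup>+x. ?q x \<partial>lborel)"
      using nn_integral_change_of_variables[OF has_derivative_grad_step[OF C2[OF \<xi>]] bij[OF \<xi>], of ?q]
      by (simp add: det_grad_step_derivative)
    then show "(\<integral>\<^sup>+x. ?q x \<partial>lborel) = (\<integral>\<^sup>+z. p z \<partial>lborel)"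
      by (simp add: h_step mult.assoc cancel)
  next
    fix \<xi> and x :: "real^'d"
    assume \<xi>: "\<xi> \<in> space \<nu>"
    show "0 < 1 / \<bar>step_det \<eta> (f \<xi>) (?h \<xi> x)\<bar>"
      using J[OF \<xi>] by simp
    show "grad_step \<eta> (f \<xi>) (?h \<xi> x) = x"
      using bij[OF \<xi>] by (simp add: bij_is_surj surj_f_inv_f)
  qed measurable
qed

theorem proposition2p1:
  fixes \<nu> :: "(real^'k) measure"
    and f :: "real^'k \<Rightarrow> real^'d \<Rightarrow> real"
  assumes "prob_space \<nu>"
    and "sets \<nu> = sets (restrict_space borel (space \<nu>))"
    and "\<And>x. (\<lambda>\<xi>. f \<xi> x) \<in> borel_measurable \<nu>"
    and "\<And>\<xi>. \<xi> \<in> space \<nu> \<Longrightarrow> Ck 2 (f \<xi>)"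
    and "(SUP \<xi>\<in>space \<nu>. Ck_norm 2 (f \<xi>)) < \<infinity>"
  shows "\<exists>\<eta>\<^sub>0>0. \<forall>\<eta>. 0 < \<eta> \<and> \<eta> < \<eta>\<^sub>0 \<longrightarrow>
    (\<forall>\<xi>\<in>space \<nu>. bij (grad_step \<eta> (f \<xi>)) \<and> (\<forall>x. step_det \<eta> (f \<xi>) x \<noteq> 0)) \<and>
    (\<forall>u\<in>Linf. AE x in lborel. integrable \<nu> (\<lambda>\<xi>. u (grad_step \<eta> (f \<xi>) x))) \<and>
    maps_classes (S_op \<nu> f \<eta>) Linf Linf \<and>
    (\<exists>Sstar. maps_classes Sstar L1 L1 \<and>
      is_dual_of (S_op \<nu> f \<eta>) Sstar \<and>
      (\<forall>\<rho>\<in>L1. AE x in lborel. has_bochner_integral \<nu>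
         (\<lambda>\<xi>. ((\<lambda>z. \<rho> z / \<bar>step_det \<eta> (f \<xi>) z\<bar>) \<circ> inv (grad_step \<eta> (f \<xi>))) x)
         (Sstar \<rho> x)) \<and>
      (\<forall>\<rho>\<in>L1. (\<integral>x. Sstar \<rho> x \<partial>lborel) = (\<integral>x. \<rho> x \<partial>lborel)) \<and>
      (\<forall>\<rho>\<in>L1. (AE x in lborel. \<rho> x \<ge> 0) \<longrightarrow>
         (AE x in lborel. Sstar \<rho> x \<ge> 0) \<and> L1_norm (Sstar \<rho>) = L1_norm \<rho>) \<and>
      (\<forall>\<rho>\<in>L1. L1_norm (Sstar \<rho>) \<le> L1_norm \<rho>))"
proof -
  define M where "M = enn2real (SUP \<xi>\<in>space \<nu>. Ck_norm 2 (f \<xi>))"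
  have M: "\<bar>partial i (partial j (f \<xi>)) x\<bar> \<le> M" if "\<xi> \<in> space \<nu>" for \<xi> x i j
  proof -
    have "ennreal \<bar>partial i (partial j (f \<xi>)) x\<bar> \<le> (SUP \<xi>\<in>space \<nu>. Ck_norm 2 (f \<xi>))"
      by (rule order_trans[OF second_partial_le_Ck_norm[OF assms(4)[OF that]]]) (rule SUP_upper[OF that])
    also have "\<dots> = ennreal M"
      using assms(5) by (simp add: M_def)
    finally show ?thesis
      by (simp add: M_def)
  qed
  define L where "L = (real CARD('d))\<^sup>2 * M"
  have "0 \<le> L"
    by (simp add: L_def M_def)
  \<comment> \<open>The summand 1 keeps the threshold positive when \<open>L = 0\<close>.\<close>
  show ?thesis
  proof (rule exI[of _ "1 / (L + 1)"], rule conjI[rotated], intro allI impI)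
    show "0 < 1 / (L + 1)"
      using \<open>0 \<le> L\<close> by simp
  next
    fix \<eta> assume \<eta>: "0 < \<eta> \<and> \<eta> < 1 / (L + 1)"
    have "\<eta> * L + \<eta> < 1"
      using \<eta> \<open>0 \<le> L\<close> by (simp add: field_simps)
    then have small: "0 \<le> \<eta>" "\<eta> * ((real CARD('d))\<^sup>2 * M) < 1"
      using \<eta> by (auto simp: L_def)
    interpret random_diffeomorphism \<nu> "\<lambda>\<xi>. grad_step \<eta> (f \<xi>)" "\<lambda>\<xi>. inv (grad_step \<eta> (f \<xi>))"
      "\<lambda>\<xi> x. 1 / \<bar>step_det \<eta> (f \<xi>) (inv (grad_step \<eta> (f \<xi>)) x)\<bar>"
      by (rule random_diffeomorphism_grad_step[OF assms(1,3,4) M small])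
    have S_op: "S_op \<nu> f \<eta> = S"
      by (simp add: S_op_def S_def fun_eq_iff)
    have bochner: "AE x in lborel. has_bochner_integral \<nu>
         (\<lambda>\<xi>. ((\<lambda>z. \<rho> z / \<bar>step_det \<eta> (f \<xi>) z\<bar>) \<circ> inv (grad_step \<eta> (f \<xi>))) x) (S_dual \<rho> x)"
      if "\<rho> \<in> L1" for \<rho>
      using AE_integrable_S_dual[OF that]
      by eventually_elim (simp add: has_bochner_integral_iff S_dual_def)
    show "(\<forall>\<xi>\<in>space \<nu>. bij (grad_step \<eta> (f \<xi>)) \<and> (\<forall>x. step_det \<eta> (f \<xi>) x \<noteq> 0)) \<and>
      (\<forall>u\<in>Linf. AE x in lborel. integrable \<nu> (\<lambda>\<xi>. u (grad_step \<eta> (f \<xi>) x))) \<and>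
      maps_classes (S_op \<nu> f \<eta>) Linf Linf \<and>
      (\<exists>Sstar. maps_classes Sstar L1 L1 \<and>
        is_dual_of (S_op \<nu> f \<eta>) Sstar \<and>
        (\<forall>\<rho>\<in>L1. AE x in lborel. has_bochner_integral \<nu>
           (\<lambda>\<xi>. ((\<lambda>z. \<rho> z / \<bar>step_det \<eta> (f \<xi>) z\<bar>) \<circ> inv (grad_step \<eta> (f \<xi>))) x)
           (Sstar \<rho> x)) \<and>
        (\<forall>\<rho>\<in>L1. (\<integral>x. Sstar \<rho> x \<partial>lborel) = (\<integral>x. \<rho> x \<partial>lborel)) \<and>
        (\<forall>\<rho>\<in>L1. (AE x in lborel. \<rho> x \<ge> 0) \<longrightarrow>
           (AE x in lborel. Sstar \<rho> x \<ge> 0) \<and> L1_norm (Sstar \<rho>) = L1_norm \<rho>) \<and>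
        (\<forall>\<rho>\<in>L1. L1_norm (Sstar \<rho>) \<le> L1_norm \<rho>))"
      unfolding S_op
      by (intro conjI ballI allI impI exI[of _ S_dual] S_maps_classes S_dual_maps_classes S_is_dual
          bochner AE_integrable_S integral_S_dual S_dual_nonneg L1_norm_S_dual_nonneg L1_norm_S_dual_le
          bij_grad_step[OF assms(4) M small] step_det_nonzero[OF M small])
  qed
qed

end
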